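(* Every plane Laman graph admits an extended weak labeling.
   Context: A Laman graph is a graph with $n$ vertices and $2n-3$ edges such that every induced subgraph on $k\ge 2$ vertices has at most $2k-3$ edges; a plane Laman graph is a Laman graph with a fixed planar embedding. An angle is an incidence of a vertex with a face. An extended weak labeling of a plane Laman graph $G$ is a map from its angles to $\{0,1\}$ such that: (G$0'$) there are two adjacent special vertices $s_0,s_1$ such that all angles at $s_i$ are labeled $i$; (G1) for each vertex $v\notin\{s_0,s_1\}$ the labels around $v$ form one non-empty cyclic interval of $1$s and one non-empty cyclic interval of $0$s; (G$2'$) for each edge other than $s_0s_1$, the two labels on the two sides of the edge coincide at one endpoint and differ at the other; (G3) for each face (including the outer face), its labels, read cyclically, form one non-empty interval of $1$s and one non-empty interval of $0$s. *)

theory Defs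
  imports Main
begin

section \<open>Finite simple graphs\<close>

text \<open>A finite simple graph: vertex set V, edges are 2-element subsets of V.\<close>
definition simple_graph :: "'a set \<Rightarrow> 'a set set \<Rightarrow> bool" where
  "simple_graph V E \<longleftrightarrow> finite V \<and>
     (\<forall>e\<in>E. \<exists>u v. e = {u, v} \<and> u \<noteq> v \<and> u \<in> V \<and> v \<in> V)"

definition nbrs :: "'a set set \<Rightarrow> 'a \<Rightarrow> 'a set" where
  "nbrs E v = {u. {u, v} \<in> E}"

text \<open>Laman graph: n vertices, 2n-3 edges, every induced subgraph on k \<ge> 2 vertices
  has at most 2k-3 edges.\<close>
definition laman_graph :: "'a set \<Rightarrow> 'a set set \<Rightarrow> bool" where
  "laman_graph V E \<longleftrightarrow> simple_graph V E \<and>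
     int (card E) = 2 * int (card V) - 3 \<and>
     (\<forall>S\<subseteq>V. card S \<ge> 2 \<longrightarrow> int (card {e\<in>E. e \<subseteq> S}) \<le> 2 * int (card S) - 3)"

definition connected_graph :: "'a set \<Rightarrow> 'a set set \<Rightarrow> bool" where
  "connected_graph V E \<longleftrightarrow>
     (\<forall>u\<in>V. \<forall>v\<in>V. (u, v) \<in> {(x, y). {x, y} \<in> E}\<^sup>*)"

section \<open>Plane embeddings as rotation systems\<close>

text \<open>f acts on the finite set S as a single cyclic permutation.\<close>
definition cyclic_on :: "('b \<Rightarrow> 'b) \<Rightarrow> 'b set \<Rightarrow> bool" where
  "cyclic_on f S \<longleftrightarrow> finite S \<and> bij_betw f S S \<and>
     (\<forall>x\<in>S. \<forall>y\<in>S. \<exists>n. (f ^^ n) x = y)"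

text \<open>A rotation system: rot v is the cyclic (counterclockwise) successor of neighbours
  around v.\<close>
definition rotation_system :: "'a set \<Rightarrow> 'a set set \<Rightarrow> ('a \<Rightarrow> 'a \<Rightarrow> 'a) \<Rightarrow> bool" where
  "rotation_system V E rot \<longleftrightarrow> (\<forall>v\<in>V. cyclic_on (rot v) (nbrs E v))"

text \<open>Darts (directed edges). The dart (u,v) also names the angle (corner) at v
  between the edges vu and v(rot v u).\<close>
definition darts :: "'a set set \<Rightarrow> ('a \<times> 'a) set" where
  "darts E = {(u, v). {u, v} \<in> E}"

text \<open>Face traversal permutation.\<close>
definition face_step :: "('a \<Rightarrow> 'a \<Rightarrow> 'a) \<Rightarrow> 'a \<times> 'a \<Rightarrow> 'a \<times> 'a" where
  "face_step rot d = (snd d, rot (snd d) (fst d))"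

definition face_of :: "('a \<Rightarrow> 'a \<Rightarrow> 'a) \<Rightarrow> 'a \<times> 'a \<Rightarrow> ('a \<times> 'a) set" where
  "face_of rot d = {(face_step rot ^^ n) d | n. True}"

definition faces :: "'a set set \<Rightarrow> ('a \<Rightarrow> 'a \<Rightarrow> 'a) \<Rightarrow> ('a \<times> 'a) set set" where
  "faces E rot = face_of rot ` darts E"

text \<open>A planar (genus 0) embedding of a connected graph, given combinatorially by
  a rotation system satisfying Euler's formula V - E + F = 2.\<close>
definition plane_embedding :: "'a set \<Rightarrow> 'a set set \<Rightarrow> ('a \<Rightarrow> 'a \<Rightarrow> 'a) \<Rightarrow> bool" where
  "plane_embedding V E rot \<longleftrightarrow> simple_graph V E \<and> connected_graph V E \<and>
     rotation_system V E rot \<and>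
     int (card V) - int (card E) + int (card (faces E rot)) = 2"

section \<open>Extended weak labelings\<close>

text \<open>Reading the labels l along the cycle of f on S (starting suitably) gives
  one non-empty interval of 1s followed by one non-empty interval of 0s.\<close>
definition one_interval_each :: "('b \<Rightarrow> 'b) \<Rightarrow> 'b set \<Rightarrow> ('b \<Rightarrow> nat) \<Rightarrow> bool" where
  "one_interval_each f S l \<longleftrightarrow> (\<exists>x\<in>S. \<exists>k. 0 < k \<and> k < card S \<and>
     (\<forall>i<card S. l ((f ^^ i) x) = (if i < k then 1 else 0)))"

text \<open>At endpoint v of edge uv, the labels of the two angles on the two sides of the
  edge coincide: the angle (u,v) following vu and the angle (x,v) preceding vu.\<close>
definition sides_coincide_at :: "'a set set \<Rightarrow> ('a \<Rightarrow> 'a \<Rightarrow> 'a) \<Rightarrow> ('a \<times> 'a \<Rightarrow> nat)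
    \<Rightarrow> 'a \<Rightarrow> 'a \<Rightarrow> bool" where
  "sides_coincide_at E rot l v u \<longleftrightarrow>
     (\<forall>x. {x, v} \<in> E \<and> rot v x = u \<longrightarrow> l (x, v) = l (u, v))"

definition extended_weak_labeling ::
    "'a set \<Rightarrow> 'a set set \<Rightarrow> ('a \<Rightarrow> 'a \<Rightarrow> 'a) \<Rightarrow> ('a \<times> 'a \<Rightarrow> nat) \<Rightarrow> bool" where
  "extended_weak_labeling V E rot l \<longleftrightarrow>
     (\<forall>d\<in>darts E. l d \<in> {0, 1}) \<and>
     (\<exists>s0 s1. {s0, s1} \<in> E \<and>
        \<comment> \<open>(G0')\<close>
        (\<forall>u\<in>nbrs E s0. l (u, s0) = 0) \<and> (\<forall>u\<in>nbrs E s1. l (u, s1) = 1) \<and>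
        \<comment> \<open>(G1)\<close>
        (\<forall>v\<in>V - {s0, s1}. one_interval_each (rot v) (nbrs E v) (\<lambda>u. l (u, v))) \<and>
        \<comment> \<open>(G2')\<close>
        (\<forall>u v. {u, v} \<in> E - {{s0, s1}} \<longrightarrow>
            sides_coincide_at E rot l v u \<noteq> sides_coincide_at E rot l u v) \<and>
        \<comment> \<open>(G3)\<close>
        (\<forall>F\<in>faces E rot. one_interval_each (face_step rot) F l))"

end

theory Submission
  imports Defs
begin

text \<open>
  An extended weak labeling orients every edge other than \<open>s\<^sub>0s\<^sub>1\<close> away from the endpoint at which its two
  sides differ; all vertices but \<open>s\<^sub>0\<close>, \<open>s\<^sub>1\<close> then have out-degree 2. Such an edge causes a change of label
  along exactly one of its two sides and \<open>s\<^sub>0s\<^sub>1\<close> along both, which makes \<open>|E| + 1 = 2n - 2 = 2|F|\<close> changes in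
  total by Euler's formula. So (G3) holds as soon as no face is monochromatic.

  The weaker requirement that no face be monochromatic can be met for every rotation system of a Laman graph,
  of any genus, and for every prescribed edge \<open>s\<^sub>0s\<^sub>1\<close>, by induction along Henneberg steps. Counting degrees
  yields a vertex \<open>v\<close> of degree 2 or 3 outside \<open>{s\<^sub>0, s\<^sub>1}\<close>; remove it, and if its degree is 3, join a suitable
  pair \<open>a\<close>, \<open>b\<close> of its neighbours by an edge drawn along the path \<open>avb\<close>. A labeling of the smaller graph extends
  to \<open>v\<close> in two ways that differ in one bit. If both left a monochromatic face, these two faces together
  would contain a monochromatic face of the smaller graph.
\<close>

subsection \<open>Cyclic permutations\<close>

text \<open>Closed sets replace iteration counts in the later surgery on cycles. The orbit of a
  point of \<open>T\<close> stays in \<open>T\<close> and reaches all of \<open>S\<close>;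
  conversely, the orbit of any point is itself a non-empty closed set.\<close>

lemma cyclic_on_iff_minimal:
  "cyclic_on f S \<longleftrightarrow> finite S \<and> bij_betw f S S \<and> (\<forall>T\<subseteq>S. T \<noteq> {} \<and> f ` T \<subseteq> T \<longrightarrow> T = S)"
proof (intro iffI conjI)
  assume c: "cyclic_on f S"
  then show "finite S" "bij_betw f S S" by (auto simp: cyclic_on_def)
  show "\<forall>T\<subseteq>S. T \<noteq> {} \<and> f ` T \<subseteq> T \<longrightarrow> T = S"
  proof (intro allI impI)
    fix T assume T: "T \<subseteq> S" "T \<noteq> {} \<and> f ` T \<subseteq> T"
    then obtain x where x: "x \<in> T" by auto
    have it: "(f ^^ n) x \<in> T" for n using x T by (induction n) auto
    show "T = S"
    proof
      show "S \<subseteq> T"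
      proof
        fix y assume "y \<in> S"
        then obtain n where "(f ^^ n) x = y" using c x T unfolding cyclic_on_def by blast
        then show "y \<in> T" using it by auto
      qed
    qed (use T in auto)
  qed
next
  assume m: "finite S \<and> bij_betw f S S \<and> (\<forall>T\<subseteq>S. T \<noteq> {} \<and> f ` T \<subseteq> T \<longrightarrow> T = S)"
  have "\<exists>n. (f ^^ n) x = y" if x: "x \<in> S" and y: "y \<in> S" for x y
  proof -
    define T where "T = {(f ^^ n) x | n. True}"
    have "(f ^^ n) x \<in> S" for n
      using x m by (induction n) (auto simp: bij_betw_def)
    then have sub: "T \<subseteq> S" unfolding T_def by auto
    have "f ((f ^^ n) x) \<in> T" for n
      unfolding T_def by (rule CollectI, rule exI[of _ "Suc n"]) simp
    then have "f ` T \<subseteq> T" unfolding T_def by auto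
    moreover have "x \<in> T" unfolding T_def by (rule CollectI, rule exI[of _ 0]) simp
    ultimately have "T = S" using m sub by blast
    then show ?thesis using y unfolding T_def by auto
  qed
  then show "cyclic_on f S" using m by (auto simp: cyclic_on_def)
qed

text \<open>An injective self-map of the finite set \<open>T\<close> is onto \<open>T\<close>. Hence
  closed sets, and faces in particular, can also be followed backwards.\<close>

lemma bij_betw_inv_closed:
  assumes "finite D" "bij_betw f D D" "T \<subseteq> D" "f ` T \<subseteq> T" "x \<in> D" "f x \<in> T"
  shows "x \<in> T"
proof -
  have inj: "inj_on f D" using assms(2) by (auto simp: bij_betw_def)
  then have "f ` T = T"
    using assms endo_inj_surj[of T f] by (meson finite_subset inj_on_subset)
  then obtain t where "t \<in> T" "f t = f x" using assms(6) by (metis imageE)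
  then show ?thesis using inj assms by (metis inj_onD subsetD)
qed

lemma cyclic_on_orbit:
  assumes "finite D" "bij_betw f D D" "x \<in> D"
  shows "cyclic_on f {(f ^^ n) x | n. True}"
proof -
  define S where "S = {(f ^^ n) x | n. True}"
  have "(f ^^ n) x \<in> D" for n using assms by (induction n) (auto simp: bij_betw_def)
  then have sub: "S \<subseteq> D" unfolding S_def by auto
  have fin: "finite S" using sub assms(1) finite_subset by blast
  have inj: "inj_on f S" using assms(2) sub by (meson bij_betw_def inj_on_subset)
  have "f ((f ^^ n) x) \<in> S" for n
    unfolding S_def by (rule CollectI, rule exI[of _ "Suc n"]) simp
  then have cl: "f ` S \<subseteq> S" unfolding S_def by auto
  have bij: "bij_betw f S S" using endo_inj_surj[OF fin cl inj] inj by (simp add: bij_betw_def)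
  have x: "x \<in> S" unfolding S_def by (rule CollectI, rule exI[of _ 0]) simp
  have gen: "S \<subseteq> T" if "x \<in> T" "f ` T \<subseteq> T" for T
  proof -
    have "(f ^^ n) x \<in> T" for n using that by (induction n) auto
    then show ?thesis unfolding S_def by auto
  qed
  have "T = S" if T: "T \<subseteq> S" "T \<noteq> {}" "f ` T \<subseteq> T" for T
  proof (cases "x \<in> T")
    case True then show ?thesis using gen T by blast
  next
    case False
    \<comment> \<open>By backward closure the complement of \<open>T\<close> is closed too;
      containing \<open>x\<close>, it contains the whole orbit, which leaves \<open>T\<close>
      empty.\<close>
    have "f ` (S - T) \<subseteq> S - T" using bij_betw_inv_closed[OF fin bij T(1,3)] cl by blast
    then have "S \<subseteq> S - T" using gen[of "S - T"] False x by blast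
    then show ?thesis using T by blast
  qed
  then show ?thesis unfolding S_def[symmetric] cyclic_on_iff_minimal using fin bij by auto
qed

text \<open>A return after \<open>p\<close> steps yields a closed set of at most \<open>p\<close>
  points, which must be all of \<open>S\<close>. So no return takes fewer than \<open>card S\<close>
  steps, and a repetition among the first \<open>card S\<close> iterates would be such a
  return.\<close>

lemma cyclic_on_enum:
  assumes c: "cyclic_on f S" and x: "x \<in> S"
  shows "inj_on (\<lambda>i. (f ^^ i) x) {..<card S}" "(\<lambda>i. (f ^^ i) x) ` {..<card S} = S"
proof -
  have fin: "finite S" and bij: "bij_betw f S S" using c by (auto simp: cyclic_on_def)
  have inS: "(f ^^ n) x \<in> S" for n using x bij by (induction n) (auto simp: bij_betw_def)
  have canc: "(f ^^ j) x = x" if "(f ^^ (i + j)) x = (f ^^ i) x" for i j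
    using that
  proof (induction i)
    case (Suc i)
    then have "f ((f ^^ (i + j)) x) = f ((f ^^ i) x)" by simp
    then have "(f ^^ (i + j)) x = (f ^^ i) x"
      using inS bij by (meson bij_betw_def inj_onD)
    then show ?case using Suc by simp
  qed simp
  have full: "(\<lambda>i. (f ^^ i) x) ` {..<p} = S" if p: "p > 0" "(f ^^ p) x = x" for p
  proof -
    have "f ((f ^^ i) x) \<in> (\<lambda>i. (f ^^ i) x) ` {..<p}" if "i < p" for i
    proof (cases "Suc i = p")
      case True
      then have "f ((f ^^ i) x) = (f ^^ 0) x" using p by auto
      then show ?thesis using p by blast
    next
      case False then show ?thesis using that by (intro image_eqI[of _ _ "Suc i"]) auto
    qed
    then have "f ` (\<lambda>i. (f ^^ i) x) ` {..<p} \<subseteq> (\<lambda>i. (f ^^ i) x) ` {..<p}" by blast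
    moreover have "(\<lambda>i. (f ^^ i) x) ` {..<p} \<subseteq> S" using inS by blast
    moreover have "(\<lambda>i. (f ^^ i) x) ` {..<p} \<noteq> {}" using p(1) by auto
    ultimately show ?thesis using c unfolding cyclic_on_iff_minimal by blast
  qed
  have lower: "card S \<le> p" if "p > 0" "(f ^^ p) x = x" for p
    using full[OF that] card_image_le[of "{..<p}" "\<lambda>i. (f ^^ i) x"] by simp
  show inj: "inj_on (\<lambda>i. (f ^^ i) x) {..<card S}"
  proof (rule linorder_inj_onI)
    fix i j assume ij: "i < j" "i \<in> {..<card S}" "j \<in> {..<card S}"
    show "(f ^^ i) x \<noteq> (f ^^ j) x"
    proof
      assume "(f ^^ i) x = (f ^^ j) x"
      then have "(f ^^ (j - i)) x = x" using canc[of i "j - i"] ij by simp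
      then show False using lower[of "j - i"] ij by auto
    qed
  qed auto
  show "(\<lambda>i. (f ^^ i) x) ` {..<card S} = S"
    using inS inj fin by (intro card_subset_eq) (auto simp: card_image)
qed

section \<open>Label changes along a cycle\<close>

definition switches :: "('b \<Rightarrow> 'b) \<Rightarrow> 'b set \<Rightarrow> ('b \<Rightarrow> bool) \<Rightarrow> 'b set" where
  "switches f S L = {x \<in> S. L x \<noteq> L (f x)}"

text \<open>Without an ascent, the elements with label false would form a closed, proper, non-empty
  subset.\<close>

lemma cyclic_on_ascent:
  assumes c: "cyclic_on f S" and n: "\<exists>x\<in>S. L x" "\<exists>x\<in>S. \<not> L x"
  shows "\<exists>x\<in>S. \<not> L x \<and> L (f x)"
proof (rule ccontr)
  assume a: "\<not> ?thesis"
  have "f ` S \<subseteq> S" using c by (auto simp: cyclic_on_def bij_betw_def)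
  then have "f ` {x\<in>S. \<not> L x} \<subseteq> {x\<in>S. \<not> L x}" using a by auto
  moreover have "{x\<in>S. \<not> L x} \<noteq> {}" "{x\<in>S. \<not> L x} \<subseteq> S" "{x\<in>S. \<not> L x} \<noteq> S" using n by auto
  ultimately show False using c unfolding cyclic_on_iff_minimal by metis
qed

text \<open>An ascent of \<open>L\<close> and an ascent of its negation are two different
  switches.\<close>

lemma card_switches_ge_2:
  assumes c: "cyclic_on f S" and n: "\<exists>x\<in>S. L x" "\<exists>x\<in>S. \<not> L x"
  shows "card (switches f S L) \<ge> 2"
proof -
  obtain x where x: "x \<in> S" "\<not> L x" "L (f x)" using cyclic_on_ascent[OF c n] by auto
  obtain y where y: "y \<in> S" "L y" "\<not> L (f y)"
    using cyclic_on_ascent[OF c, of "\<lambda>x. \<not> L x"] n by auto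
  have "{x, y} \<subseteq> switches f S L" using x y by (auto simp: switches_def)
  moreover have "finite (switches f S L)" using c by (auto simp: switches_def cyclic_on_def)
  moreover have "x \<noteq> y" using x y by auto
  then have "card {x, y} = 2" by simp
  ultimately show ?thesis by (metis card_mono)
qed

lemma one_interval_each_if_two_switches:
  assumes c: "cyclic_on f S" and W: "card (switches f S L) = 2"
  shows "one_interval_each f S (\<lambda>x. if L x then 1 else 0)"
proof -
  have fin: "finite S" and im: "f ` S = S" using c by (auto simp: cyclic_on_def bij_betw_def)
  have "switches f S L \<noteq> {}" using W by auto
  then have n: "\<exists>x\<in>S. L x" "\<exists>x\<in>S. \<not> L x" using im by (auto simp: switches_def)
  obtain p where p: "p \<in> S" "\<not> L p" "L (f p)" using cyclic_on_ascent[OF c n] by auto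
  \<comment> \<open>Starting just after an ascent puts a true label first and, because
    \<open>p\<close> precedes \<open>x\<close>, a false label last, so that neither interval wraps
    around.\<close>
  define x where "x = f p"
  have x: "x \<in> S" using p im by (auto simp: x_def)
  define g where "g i = (f ^^ i) x" for i
  note enum = cyclic_on_enum[OF c x, folded g_def]
  have gS: "g (Suc i) = f (g i)" for i by (simp add: g_def)
  define N where "N = card S"
  have inS: "g i \<in> S" if "i < N" for i using enum(2) that unfolding N_def by blast
  obtain j where j: "j < N" "g j = p" using enum(2) p(1) unfolding N_def by (metis imageE lessThan_iff)
  \<comment> \<open>Otherwise \<open>x\<close>, the successor of \<open>p\<close>, would occur twice
    among the first \<open>N\<close> iterates.\<close>
  have jN: "Suc j = N"
  proof (rule ccontr)
    assume "Suc j \<noteq> N"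
    then have *: "Suc j < N" using j by simp
    have "g (Suc j) = g 0" using gS j by (simp add: g_def x_def)
    then show False using enum(1) * unfolding N_def inj_on_def
      by (metis lessThan_iff less_trans_Suc nat.distinct(1) gr_implies_not0 not_gr_zero)
  qed
  define k where "k = (LEAST i. \<not> L (g i))"
  have kL: "\<not> L (g k)" unfolding k_def by (rule LeastI[of _ j]) (use j p in auto)
  have kmin: "L (g i)" if "i < k" for i using that not_less_Least unfolding k_def by blast
  have kj: "k \<le> j" unfolding k_def by (rule Least_le) (use j p in auto)
  have k0: "k > 0"
  proof (rule ccontr)
    assume "\<not> k > 0" then have "k = 0" by simp
    then show False using kL p by (simp add: g_def x_def)
  qed
  have post: "\<not> L (g i)" if "k \<le> i" "i < N" for i
    using that
  proof (induction i rule: dec_induct)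
    case (step i)
    then have ni: "\<not> L (g i)" by simp
    show ?case
    proof
      assume a: "L (g (Suc i))"
      \<comment> \<open>A return to true would be a third switch, besides the descent at position
        \<open>k - 1\<close> and the ascent at the last position \<open>j\<close>.\<close>
      have "{g (k - 1), g i, g j} \<subseteq> switches f S L"
        using inS[of "k-1"] inS[of i] inS[of j] kL kmin[of "k - 1"] k0 kj jN ni a step gS[of "k-1"] gS[of i] j p
        by (auto simp: switches_def)
      moreover have ij: "i \<noteq> j" using step jN by auto
      have "card {g (k - 1), g i, g j} = 3"
      proof -
        have "card (g ` {k - 1, i, j}) = card {k - 1, i, j}"
          by (rule card_image, rule inj_on_subset[OF enum(1)]) (use step kj jN N_def in auto)
        moreover have "card {k - 1, i, j} = 3" using ij k0 kj step by (auto simp: card_insert_if)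
        ultimately show ?thesis by simp
      qed
      moreover have "finite (switches f S L)" using fin by (auto simp: switches_def)
      ultimately have "3 \<le> card (switches f S L)" by (metis card_mono)
      then show False using W by simp
    qed
  qed (use kL in auto)
  show ?thesis unfolding one_interval_each_def
  proof (intro bexI[OF _ x] exI[of _ k] conjI allI impI)
    show "0 < k" by fact
    show "k < card S" using kj jN N_def by simp
    fix i assume "i < card S"
    then show "(if L ((f ^^ i) x) then 1 else 0) = (if i < k then 1 else 0)"
      using kmin[of i] post[of i] by (auto simp: g_def N_def)
  qed
qed

section \<open>Deleting and renaming a point of a cycle\<close>

lemma cyclic_on_conj:
  assumes "cyclic_on f S" "bij_betw t S T" "\<And>x. x \<in> S \<Longrightarrow> g (t x) = t (f x)"
  shows "cyclic_on g T"
proof -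
  have im: "t ` S = T" and it: "inj_on t S" using assms(2) by (auto simp: bij_betw_def)
  have fS: "f x \<in> S" if "x \<in> S" for x using assms(1) that by (auto simp: cyclic_on_def bij_betw_def)
  have pw: "(f ^^ n) x \<in> S \<and> (g ^^ n) (t x) = t ((f ^^ n) x)" if "x \<in> S" for n x
    using that by (induction n) (auto simp: fS assms(3))
  have fin: "finite T" using assms(1) im by (auto simp: cyclic_on_def)
  have "f ` S = S" using assms(1) by (auto simp: cyclic_on_def bij_betw_def)
  then have "g ` T = T" unfolding im[symmetric] image_image using assms(3)
    by (metis (no_types, lifting) image_cong image_image)
  then have "bij_betw g T T" using fin by (simp add: bij_betw_def eq_card_imp_inj_on)
  moreover have "\<exists>n. (g ^^ n) x = y" if xy: "x \<in> T" "y \<in> T" for x y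
  proof -
    obtain x' y' where s: "x' \<in> S" "y' \<in> S" "x = t x'" "y = t y'" using xy im by blast
    then obtain n where "(f ^^ n) x' = y'" using assms(1) unfolding cyclic_on_def by blast
    then show ?thesis using pw[OF s(1), of n] s by auto
  qed
  ultimately show ?thesis using fin by (auto simp: cyclic_on_def)
qed

text \<open>On the complement of \<open>v\<close> this is the first-return map of \<open>f\<close>.
  It gives the rotation at a vertex after its edge to \<open>v\<close> is deleted.\<close>

definition skip :: "'b \<Rightarrow> ('b \<Rightarrow> 'b) \<Rightarrow> 'b \<Rightarrow> 'b" where
  "skip v f x = (if f x = v then f v else f x)"

text \<open>A set closed under the new map either never reaches \<open>v\<close> under
  \<open>f\<close>, and is then closed under \<open>f\<close>, or becomes so once \<open>v\<close>
  is added. The case of \<open>v\<close> outside \<open>S\<close> is that of a vertex not adjacent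
  to \<open>v\<close>.\<close>

lemma cyclic_on_skip:
  assumes "cyclic_on f S"
  shows "cyclic_on (skip v f) (S - {v})"
proof -
  have fin: "finite S" and bij: "bij_betw f S S"
    and min: "\<And>T. T \<subseteq> S \<Longrightarrow> T \<noteq> {} \<Longrightarrow> f ` T \<subseteq> T \<Longrightarrow> T = S"
    using assms by (auto simp: cyclic_on_iff_minimal)
  have inj: "inj_on f S" and im: "\<And>x. x \<in> S \<Longrightarrow> f x \<in> S" using bij by (auto simp: bij_betw_def)
  have cl: "skip v f x \<in> S - {v}" if "x \<in> S - {v}" for x
    using that im inj unfolding skip_def inj_on_def by auto
  have "inj_on (skip v f) (S - {v})"
  proof (rule inj_onI)
    fix x y assume xy: "x \<in> S - {v}" "y \<in> S - {v}" "skip v f x = skip v f y"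
    have vS: "v \<in> S" if "f x = v \<or> f y = v" using that xy im by blast
    show "x = y"
    proof (cases "f x = v")
      case True
      show ?thesis
      proof (cases "f y = v")
        case False
        then have "f v = f y" using True xy by (simp add: skip_def)
        then show ?thesis using inj_onD[OF inj, of v y] vS True xy by blast
      qed (use True xy inj_onD[OF inj, of x y] in simp)
    next
      case False
      then have "f x = f (if f y = v then v else y)" using xy(3) by (simp add: skip_def split: if_splits)
      then have "x = (if f y = v then v else y)"
        using inj_onD[OF inj, of x "if f y = v then v else y"] vS xy by (simp split: if_splits)
      then show ?thesis using xy by (simp split: if_splits)
    qed
  qed
  then have b: "bij_betw (skip v f) (S - {v}) (S - {v})"
    unfolding bij_betw_def using cl fin by (intro conjI endo_inj_surj) auto
  have "T = S - {v}" if T: "T \<subseteq> S - {v}" "T \<noteq> {}" "skip v f ` T \<subseteq> T" for T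
  proof (cases "v \<in> f ` T")
    case False
    then have "f ` T \<subseteq> T" using T(3) by (auto simp: skip_def image_subset_iff split: if_splits)
    then have "T = S" using min[of T] T by blast
    then show ?thesis using T by blast
  next
    case True
    then have "f v \<in> T" using T(3) by (auto simp: skip_def image_subset_iff)
    then have "f ` (insert v T) \<subseteq> insert v T"
      using T(3) by (auto simp: skip_def image_subset_iff split: if_splits)
    moreover have "v \<in> S" using True T im by blast
    ultimately have "insert v T = S" using min[of "insert v T"] T by blast
    then show ?thesis using T by blast
  qed
  then show ?thesis unfolding cyclic_on_iff_minimal using fin b by auto
qed
text \<open>A fixed point would be a closed proper subset. The predecessor \<open>p\<close> names
  the angle in front of the edge to a vertex that is to be removed.\<close>

lemma cyclic_on_pred:
  assumes "cyclic_on f S" "v \<in> S" "card S \<ge> 2"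
  shows "\<exists>p\<in>S. p \<noteq> v \<and> f p = v" "f v \<noteq> v"
proof -
  show nv: "f v \<noteq> v"
  proof
    assume "f v = v"
    then have "{v} = S" using assms(1,2) unfolding cyclic_on_iff_minimal
      by (metis empty_subsetI image_empty image_insert insert_not_empty insert_subset order_refl)
    then show False using assms(3) by auto
  qed
  have "v \<in> f ` S" using assms(1,2) by (auto simp: cyclic_on_def bij_betw_def)
  then show "\<exists>p\<in>S. p \<noteq> v \<and> f p = v" using nv by (metis imageE)
qed

text \<open>The conjugate of \<open>f\<close> under renaming \<open>v\<close> to \<open>b\<close>: a
  new edge to \<open>b\<close> takes the slot of the edge to \<open>v\<close>.\<close>

definition replace :: "'b \<Rightarrow> 'b \<Rightarrow> ('b \<Rightarrow> 'b) \<Rightarrow> 'b \<Rightarrow> 'b" where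
  "replace v b f x = (let y = f (if x = b then v else x) in if y = v then b else y)"

lemma cyclic_on_replace:
  assumes "cyclic_on f S" "v \<in> S" "b \<notin> S"
  shows "cyclic_on (replace v b f) (insert b (S - {v}))"
proof (rule cyclic_on_conj[OF assms(1)])
  show "bij_betw (\<lambda>x. if x = v then b else x) S (insert b (S - {v}))"
    using assms by (auto simp: bij_betw_def inj_on_def)
  show "replace v b f (if x = v then b else x) = (if f x = v then b else f x)" if "x \<in> S" for x
    using that assms by (auto simp: replace_def Let_def)
qed

subsection \<open>Laman graphs\<close>

definition induced_edges :: "'a set set \<Rightarrow> 'a set \<Rightarrow> 'a set set" where
  "induced_edges E S = {e \<in> E. e \<subseteq> S}"

lemma simple_graph_finite_edges:
  assumes "simple_graph V E" shows "finite E"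
proof -
  have "E \<subseteq> Pow V" using assms by (auto simp: simple_graph_def)
  then show ?thesis using assms finite_subset by (auto simp: simple_graph_def)
qed

lemma simple_graph_edge:
  assumes "simple_graph V E" "{u, w} \<in> E" shows "u \<noteq> w" "u \<in> V" "w \<in> V"
  using assms by (auto simp: simple_graph_def doubleton_eq_iff)+

lemma simple_graph_edgeE:
  assumes "simple_graph V E" "e \<in> E"
  obtains u w where "e = {u, w}" "u \<noteq> w" "u \<in> V" "w \<in> V"
  using assms by (auto simp: simple_graph_def)

section \<open>Degrees in Laman graphs\<close>

lemma card_nbrs:
  assumes "simple_graph V E"
  shows "card (nbrs E v) = card {e \<in> E. v \<in> e}"
proof (rule bij_betw_same_card)
  show "bij_betw (\<lambda>u. {u, v}) (nbrs E v) {e \<in> E. v \<in> e}"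
    unfolding bij_betw_def
  proof
    show "inj_on (\<lambda>u. {u, v}) (nbrs E v)" by (auto simp: inj_on_def doubleton_eq_iff)
    show "(\<lambda>u. {u, v}) ` nbrs E v = {e \<in> E. v \<in> e}"
    proof
      show "{e \<in> E. v \<in> e} \<subseteq> (\<lambda>u. {u, v}) ` nbrs E v"
      proof
        fix e assume e: "e \<in> {e \<in> E. v \<in> e}"
        then obtain x y where xy: "e = {x, y}" using assms by (auto simp: simple_graph_def)
        then have "e = {x, v} \<or> e = {y, v}" using e by auto
        then show "e \<in> (\<lambda>u. {u, v}) ` nbrs E v" using e by (auto simp: nbrs_def)
      qed
    qed (auto simp: nbrs_def)
  qed
qed

lemma card_edges_remove_vertex:
  assumes "simple_graph V E"
  shows "card E = card {e \<in> E. v \<notin> e} + card (nbrs E v)"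
proof -
  have "E = {e \<in> E. v \<notin> e} \<union> {e \<in> E. v \<in> e}" by auto
  moreover have "finite E" using simple_graph_finite_edges[OF assms] .
  ultimately show ?thesis unfolding card_nbrs[OF assms]
    by (subst card_Un_disjoint[symmetric]) auto
qed

lemma handshake:
  assumes "simple_graph V E"
  shows "(\<Sum>v\<in>V. card (nbrs E v)) = 2 * card E"
proof -
  have fin: "finite E" "finite V" using assms simple_graph_finite_edges by (auto simp: simple_graph_def)
  have "(\<Sum>v\<in>V. card {e \<in> E. v \<in> e}) = 2 * card E"
  proof (rule sum_multicount[OF fin(2,1)])
    show "\<forall>e\<in>E. card {v \<in> V. v \<in> e} = 2"
    proof
      fix e assume "e \<in> E"
      then obtain u w where "e = {u, w}" "u \<noteq> w" "u \<in> V" "w \<in> V"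
        using assms by (auto simp: simple_graph_def)
      moreover have "{v \<in> V. v \<in> e} = {u, w}" using calculation by auto
      ultimately show "card {v \<in> V. v \<in> e} = 2" by simp
    qed
  qed
  then show ?thesis by (simp add: card_nbrs[OF assms])
qed

lemma laman_sparse:
  assumes "laman_graph V E" "S \<subseteq> V" "card S \<ge> 2"
  shows "int (card (induced_edges E S)) \<le> 2 * int (card S) - 3"
  using assms by (auto simp: laman_graph_def induced_edges_def)

text \<open>Removing a vertex of degree at most 1 would leave \<open>n - 1\<close> vertices with at
  least \<open>2n - 4\<close> edges, one more than sparsity allows.\<close>

lemma laman_min_degree:
  assumes l: "laman_graph V E" and v: "v \<in> V" and n: "card V \<ge> 3"
  shows "card (nbrs E v) \<ge> 2"
proof -
  have s: "simple_graph V E" using l by (simp add: laman_graph_def)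
  have fin: "finite V" using s by (simp add: simple_graph_def)
  have "induced_edges E (V - {v}) = {e \<in> E. v \<notin> e}"
    using s by (auto simp: induced_edges_def simple_graph_def)
  then have "int (card {e \<in> E. v \<notin> e}) \<le> 2 * int (card (V - {v})) - 3"
    using laman_sparse[OF l, of "V - {v}"] v n fin by auto
  moreover have "card (V - {v}) = card V - 1" using v fin by simp
  moreover have "int (card E) = 2 * int (card V) - 3" using l by (simp add: laman_graph_def)
  ultimately show ?thesis using card_edges_remove_vertex[OF s, of v] n by linarith
qed

text \<open>Otherwise the degree sum would be at least \<open>4(n - 2) + 2 + 2 = 4n - 4\<close>,
  whereas twice the number of edges is \<open>4n - 6\<close>.\<close>

lemma laman_small_degree:
  assumes l: "laman_graph V E" and n: "card V \<ge> 3" and e: "{s0, s1} \<in> E"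
  shows "\<exists>v \<in> V - {s0, s1}. card (nbrs E v) \<in> {2, 3}"
proof (rule ccontr)
  assume a: "\<not> ?thesis"
  have s: "simple_graph V E" using l by (simp add: laman_graph_def)
  have fin: "finite V" using s by (simp add: simple_graph_def)
  note e' = simple_graph_edge[OF s e]
  have "card (nbrs E v) \<ge> 4" if "v \<in> V - {s0, s1}" for v
  proof -
    have "card (nbrs E v) \<ge> 2" using that laman_min_degree[OF l _ n] by blast
    moreover have "card (nbrs E v) \<noteq> 2" "card (nbrs E v) \<noteq> 3" using a that by blast+
    ultimately show ?thesis by linarith
  qed
  then have "card (V - {s0, s1}) * 4 \<le> (\<Sum>v\<in>V - {s0, s1}. card (nbrs E v))"
    using sum_bounded_below[of "V - {s0, s1}" 4 "\<lambda>v. card (nbrs E v)"] by simp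
  moreover have "card (V - {s0, s1}) = card V - 2" using e' by (simp add: card_Diff_subset)
  moreover have "(\<Sum>v\<in>V. card (nbrs E v)) = (\<Sum>v\<in>V - {s0, s1}. card (nbrs E v)) + (\<Sum>v\<in>{s0, s1}. card (nbrs E v))"
    using e' fin by (intro sum.subset_diff) auto
  moreover have "(\<Sum>v\<in>{s0, s1}. card (nbrs E v)) = card (nbrs E s0) + card (nbrs E s1)"
    using e' by simp
  moreover have "card (nbrs E s0) \<ge> 2" "card (nbrs E s1) \<ge> 2"
    using laman_min_degree[OF l _ n] e' by auto
  moreover have "int (card E) = 2 * int (card V) - 3" using l by (simp add: laman_graph_def)
  ultimately show False using handshake[OF s] n by linarith
qed

lemma simple_graph_remove_vertex:
  assumes "simple_graph V E"
  shows "simple_graph (V - {v}) {e \<in> E. v \<notin> e}"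
  using assms unfolding simple_graph_def by fastforce

lemma laman_remove_degree_2:
  assumes l: "laman_graph V E" and v: "v \<in> V" and d: "card (nbrs E v) = 2"
  shows "laman_graph (V - {v}) {e \<in> E. v \<notin> e}"
proof -
  have s: "simple_graph V E" using l by (simp add: laman_graph_def)
  have fin: "finite V" using s by (simp add: simple_graph_def)
  have "{e \<in> {e \<in> E. v \<notin> e}. e \<subseteq> S} = {e \<in> E. e \<subseteq> S}" if "S \<subseteq> V - {v}" for S using that by auto
  moreover have "card (V - {v}) = card V - 1" "card V > 0" using v fin by (auto simp: card_gt_0_iff)
  ultimately show ?thesis
    using l card_edges_remove_vertex[OF s, of v] d simple_graph_remove_vertex[OF s, of v]
    unfolding laman_graph_def by auto
qed

section \<open>Tight sets and the removal of a vertex of degree three\<close>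

lemma induced_edges_supermodular:
  assumes "finite E"
  shows "card (induced_edges E A) + card (induced_edges E B)
    \<le> card (induced_edges E (A \<union> B)) + card (induced_edges E (A \<inter> B))"
proof -
  have fin: "finite (induced_edges E S)" for S using assms by (simp add: induced_edges_def)
  have "card (induced_edges E A) + card (induced_edges E B)
    = card (induced_edges E A \<union> induced_edges E B) + card (induced_edges E A \<inter> induced_edges E B)"
    by (rule card_Un_Int[OF fin fin])
  moreover have "card (induced_edges E A \<union> induced_edges E B) \<le> card (induced_edges E (A \<union> B))"
    by (intro card_mono fin) (auto simp: induced_edges_def)
  moreover have "induced_edges E A \<inter> induced_edges E B = induced_edges E (A \<inter> B)"
    by (auto simp: induced_edges_def)
  ultimately show ?thesis by simp
qed

text \<open>The sparsity bound is attained, so no further edge fits inside \<open>S\<close>. Tight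
  sets are the obstructions to inserting an edge.\<close>

definition tight :: "'a set set \<Rightarrow> 'a set \<Rightarrow> bool" where
  "tight E S \<longleftrightarrow> card S \<ge> 2 \<and> int (card (induced_edges E S)) = 2 * int (card S) - 3"

text \<open>The sparsity bounds of union and intersection add up to the exact edge counts of
  \<open>A\<close> and \<open>B\<close>, so supermodularity forces equality. Two common vertices are
  what makes the bound apply to the intersection.\<close>

lemma tight_Un:
  assumes l: "laman_graph V E" and A: "A \<subseteq> V" "tight E A" and B: "B \<subseteq> V" "tight E B"
    and AB: "card (A \<inter> B) \<ge> 2"
  shows "tight E (A \<union> B)"
proof -
  have s: "simple_graph V E" using l by (simp add: laman_graph_def)
  have fin: "finite A" "finite B" using s A B finite_subset by (auto simp: simple_graph_def)
  have "card A \<le> card (A \<union> B)" using fin by (intro card_mono) auto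
  then have c: "card (A \<union> B) \<ge> 2" using A by (simp add: tight_def)
  have "card A + card B = card (A \<union> B) + card (A \<inter> B)" using card_Un_Int[OF fin] .
  moreover have "int (card (induced_edges E (A \<union> B))) \<le> 2 * int (card (A \<union> B)) - 3"
    "int (card (induced_edges E (A \<inter> B))) \<le> 2 * int (card (A \<inter> B)) - 3"
    using laman_sparse[OF l] A B c AB by (auto simp: le_infI1)
  ultimately show ?thesis
    using induced_edges_supermodular[OF simple_graph_finite_edges[OF s], of A B] A B c
    unfolding tight_def by linarith
qed

text \<open>Adding \<open>v\<close> to such a set would bring three edges, but one more vertex
  raises the bound by only two.\<close>

lemma laman_no_tight_around_degree_3:
  assumes l: "laman_graph V E" and v: "v \<in> V" and d: "card (nbrs E v) = 3"
    and S: "S \<subseteq> V - {v}" "nbrs E v \<subseteq> S"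
  shows "\<not> tight E S"
proof
  assume t: "tight E S"
  have s: "simple_graph V E" using l by (simp add: laman_graph_def)
  have "finite V" using s by (simp add: simple_graph_def)
  then have fin: "finite S" "finite E" using S(1) finite_subset simple_graph_finite_edges[OF s] by blast+
  have "induced_edges E S \<union> {e \<in> E. v \<in> e} \<subseteq> induced_edges E (insert v S)"
  proof -
    have "e \<subseteq> insert v S" if "e \<in> E" "v \<in> e" for e
    proof -
      obtain x y where "e = {x, y}" using simple_graph_edgeE[OF s \<open>e \<in> E\<close>] by metis
      then have "x \<in> nbrs E v \<or> x = v" "y \<in> nbrs E v \<or> y = v"
        using that by (auto simp: nbrs_def insert_commute)
      then show ?thesis using S \<open>e = {x, y}\<close> by auto
    qed
    then show ?thesis by (auto simp: induced_edges_def)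
  qed
  then have "card (induced_edges E S \<union> {e \<in> E. v \<in> e}) \<le> card (induced_edges E (insert v S))"
    using fin by (intro card_mono) (auto simp: induced_edges_def)
  moreover have "card (induced_edges E S \<union> {e \<in> E. v \<in> e}) = card (induced_edges E S) + 3"
    using fin S d card_nbrs[OF s, of v] by (subst card_Un_disjoint) (auto simp: induced_edges_def)
  moreover have "card (insert v S) = card S + 1"
    using S(1) fin by (subst card_insert_disjoint) auto
  moreover have "int (card (induced_edges E (insert v S))) \<le> 2 * int (card (insert v S)) - 3"
    using laman_sparse[OF l, of "insert v S"] S v t calculation(3) by (auto simp: tight_def)
  ultimately show False using t by (simp add: tight_def)
qed

text \<open>Only a tight set containing both ends could be overloaded by the new edge. The ends of
  an existing edge form a tight pair, which gives the first claim. One vertex and, on balance, two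
  edges disappear.\<close>

lemma laman_add_edge:
  assumes l: "laman_graph V E" and v: "v \<in> V" and d: "card (nbrs E v) = 3"
    and xy: "x \<in> V - {v}" "y \<in> V - {v}" "x \<noteq> y"
    and nt: "\<And>S. S \<subseteq> V - {v} \<Longrightarrow> x \<in> S \<Longrightarrow> y \<in> S \<Longrightarrow> \<not> tight E S"
  shows "{x, y} \<notin> E" "laman_graph (V - {v}) (insert {x, y} {e \<in> E. v \<notin> e})"
proof -
  have s: "simple_graph V E" using l by (simp add: laman_graph_def)
  have fin: "finite V" "finite E" using s simple_graph_finite_edges by (auto simp: simple_graph_def)
  show nE: "{x, y} \<notin> E"
  proof
    assume e: "{x, y} \<in> E"
    have "induced_edges E {x, y} = {{x, y}}"
    proof -
      have "e = {x, y}" if "e \<in> E" "e \<subseteq> {x, y}" for e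
      proof -
        obtain p q where "e = {p, q}" "p \<noteq> q" using simple_graph_edgeE[OF s \<open>e \<in> E\<close>] by metis
        then show ?thesis using that by auto
      qed
      then show ?thesis using e by (auto simp: induced_edges_def)
    qed
    then have "tight E {x, y}" using xy by (simp add: tight_def)
    then show False using nt[of "{x, y}"] xy by auto
  qed
  let ?E = "insert {x, y} {e \<in> E. v \<notin> e}"
  have "simple_graph (V - {v}) ?E"
    using simple_graph_remove_vertex[OF s, of v] xy unfolding simple_graph_def by blast
  moreover have "int (card ?E) = 2 * int (card (V - {v})) - 3"
  proof -
    have "card ?E = card {e \<in> E. v \<notin> e} + 1" using nE fin by simp
    moreover have "card (V - {v}) = card V - 1" "card V > 0" using v fin by (auto simp: card_gt_0_iff)
    ultimately show ?thesis using card_edges_remove_vertex[OF s, of v] d l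
      by (auto simp: laman_graph_def)
  qed
  moreover have "int (card {e \<in> ?E. e \<subseteq> S}) \<le> 2 * int (card S) - 3"
    if S: "S \<subseteq> V - {v}" "card S \<ge> 2" for S
  proof -
    have sp: "int (card (induced_edges E S)) \<le> 2 * int (card S) - 3"
      using laman_sparse[OF l] S by auto
    have fi: "finite (induced_edges E S)" using fin by (simp add: induced_edges_def)
    show ?thesis
    proof (cases "x \<in> S \<and> y \<in> S")
      case True
      have "{e \<in> ?E. e \<subseteq> S} \<subseteq> insert {x, y} (induced_edges E S)" by (auto simp: induced_edges_def)
      then have "card {e \<in> ?E. e \<subseteq> S} \<le> card (insert {x, y} (induced_edges E S))"
        using fi by (intro card_mono) auto
      also have "\<dots> \<le> card (induced_edges E S) + 1" by (simp add: card_insert_le_m1 card_insert_if fi)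
      finally show ?thesis using nt[OF S(1)] True sp S by (simp add: tight_def)
    next
      case False
      then have "{e \<in> ?E. e \<subseteq> S} \<subseteq> induced_edges E S" by (auto simp: induced_edges_def)
      then have "card {e \<in> ?E. e \<subseteq> S} \<le> card (induced_edges E S)" using fi by (intro card_mono) auto
      then show ?thesis using sp by simp
    qed
  qed
  ultimately show "laman_graph (V - {v}) ?E" by (simp add: laman_graph_def)
qed

text \<open>This inverts the Henneberg step that creates a vertex of degree 3. If every pair of
  neighbours were blocked by a tight set, two or all three of these sets would unite to a tight set
  around all neighbours of \<open>v\<close>.\<close>

lemma laman_reduce_degree_3:
  assumes l: "laman_graph V E" and v: "v \<in> V" and d: "card (nbrs E v) = 3"
  shows "\<exists>a b c. nbrs E v = {a, b, c} \<and> a \<noteq> b \<and> b \<noteq> c \<and> a \<noteq> c \<and> {a, b} \<notin> E \<and>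
    laman_graph (V - {v}) (insert {a, b} {e \<in> E. v \<notin> e})"
proof (rule ccontr)
  assume no: "\<not> ?thesis"
  have s: "simple_graph V E" using l by (simp add: laman_graph_def)
  have fin: "finite V" "finite E" using s simple_graph_finite_edges by (auto simp: simple_graph_def)
  obtain a b c where abc: "nbrs E v = {a, b, c}" "a \<noteq> b" "b \<noteq> c" "a \<noteq> c"
    using d by (auto simp: card_3_iff)
  have nV: "nbrs E v \<subseteq> V - {v}" using simple_graph_edge[OF s] by (auto simp: nbrs_def)
  have ex: "\<exists>S \<subseteq> V - {v}. x \<in> S \<and> y \<in> S \<and> tight E S"
    if "nbrs E v = {x, y, z}" "x \<noteq> y" "y \<noteq> z" "x \<noteq> z" for x y z
  proof (rule ccontr)
    assume "\<not> ?thesis"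
    then have nt: "\<not> tight E S" if "S \<subseteq> V - {v}" "x \<in> S" "y \<in> S" for S using that by blast
    have xy: "x \<in> V - {v}" "y \<in> V - {v}" using that nV by auto
    show False using no laman_add_edge[OF l v d xy that(2) nt] that by blast
  qed
  obtain A where A: "A \<subseteq> V - {v}" "a \<in> A" "b \<in> A" "tight E A" using ex[OF abc] by blast
  obtain B where B: "B \<subseteq> V - {v}" "b \<in> B" "c \<in> B" "tight E B" using ex[of b c a] abc by (auto simp: insert_commute)
  obtain C where C: "C \<subseteq> V - {v}" "a \<in> C" "c \<in> C" "tight E C" using ex[of a c b] abc by (auto simp: insert_commute)
  have big: "\<not> tight E S" if "S \<subseteq> V - {v}" "a \<in> S" "b \<in> S" "c \<in> S" for S
    using laman_no_tight_around_degree_3[OF l v d, of S] that abc by auto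
  have fABC: "finite A" "finite B" "finite C" using A B C fin by (meson finite_Diff finite_subset)+
  \<comment> \<open>Sets sharing a second vertex would already have a tight union containing all
    three neighbours.\<close>
  have one: "X \<inter> Y = {p}" if "X \<subseteq> V - {v}" "Y \<subseteq> V - {v}" "tight E X" "tight E Y" "p \<in> X \<inter> Y"
    "{a, b, c} \<subseteq> X \<union> Y" for X Y p
  proof -
    have "\<not> card (X \<inter> Y) \<ge> 2" using tight_Un[OF l, of X Y] that big[of "X \<union> Y"] by auto
    moreover have "finite (X \<inter> Y)" using that fin by (meson finite_Diff finite_Int finite_subset)
    ultimately have "card (X \<inter> Y) \<le> 1" by simp
    then have "\<forall>q\<in>X \<inter> Y. q = p" using that(5) card_le_Suc0_iff_eq[OF \<open>finite (X \<inter> Y)\<close>] by auto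
    then show ?thesis using that(5) by blast
  qed
  have i1: "A \<inter> B = {b}" using one[of A B b] A B by auto
  have i2: "A \<inter> C = {a}" using one[of A C a] A C by auto
  have i3: "B \<inter> C = {c}" using one[of B C c] B C by auto
  \<comment> \<open>An edge has two ends and so cannot lie inside a single common vertex.\<close>
  have disj: "induced_edges E X \<inter> induced_edges E Y = {}" if "X \<inter> Y = {p}" for X Y p
  proof -
    have "False" if "e \<in> E" "e \<subseteq> X" "e \<subseteq> Y" for e
    proof -
      have "e \<subseteq> {p}" using that \<open>X \<inter> Y = {p}\<close> by blast
      moreover obtain q r where "e = {q, r}" "q \<noteq> r" using simple_graph_edgeE[OF s \<open>e \<in> E\<close>] by metis
      ultimately show False by auto
    qed
    then show ?thesis by (auto simp: induced_edges_def)
  qed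
  let ?U = "A \<union> B \<union> C"
  have fi: "finite (induced_edges E X)" for X using fin by (simp add: induced_edges_def)
  have "card (induced_edges E A \<union> induced_edges E B \<union> induced_edges E C)
      = card (induced_edges E A) + card (induced_edges E B) + card (induced_edges E C)"
    using disj[OF i1] disj[OF i2] disj[OF i3] fi
    by (subst card_Un_disjoint, simp_all add: Int_Un_distrib2 card_Un_disjoint)
  moreover have "card (induced_edges E A \<union> induced_edges E B \<union> induced_edges E C) \<le> card (induced_edges E ?U)"
    by (intro card_mono fi) (auto simp: induced_edges_def)
  moreover have "card A + card B = card (A \<union> B) + 1" using card_Un_Int[of A B] fABC i1 by simp
  moreover have "card (A \<union> B) + card C = card ?U + 2"
  proof -
    have "(A \<union> B) \<inter> C = {a, c}" using i2 i3 by blast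
    then show ?thesis using card_Un_Int[of "A \<union> B" C] fABC abc by simp
  qed
  moreover have UV: "?U \<subseteq> V - {v}" using A B C by auto
  moreover have "card A \<le> card ?U" using fABC by (intro card_mono) auto
  then have c2: "card ?U \<ge> 2" using A(4) by (simp add: tight_def)
  moreover have "int (card (induced_edges E ?U)) \<le> 2 * int (card ?U) - 3"
    using laman_sparse[OF l, of ?U] UV c2 by blast
  \<comment> \<open>The three sizes sum to \<open>card ?U + 3\<close>, so the edge counts sum to
    \<open>2 * (card ?U + 3) - 9\<close>, which is exactly the bound for \<open>?U\<close>.\<close>
  ultimately have "tight E ?U" using A(4) B(4) C(4) unfolding tight_def by linarith
  then show False using big[OF UV] A B by auto
qed

subsection \<open>Labelings of rotation systems\<close>

lemma rotation_cyclic: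
  "rotation_system V E rot \<Longrightarrow> w \<in> V \<Longrightarrow> cyclic_on (rot w) (nbrs E w)"
  by (simp add: rotation_system_def)

lemma rot_edge:
  assumes "simple_graph V E" "rotation_system V E rot" "{u, w} \<in> E"
  shows "{rot w u, w} \<in> E"
proof -
  have "w \<in> V" "u \<in> nbrs E w" using simple_graph_edge[OF assms(1,3)] assms(3) by (auto simp: nbrs_def)
  then have "rot w u \<in> nbrs E w" using rotation_cyclic[OF assms(2)]
    by (auto simp: cyclic_on_def bij_betw_def)
  then show ?thesis by (simp add: nbrs_def)
qed

lemma rot_inj:
  assumes "simple_graph V E" "rotation_system V E rot" "{u, w} \<in> E" "{u', w} \<in> E" "rot w u = rot w u'"
  shows "u = u'"
proof -
  have "w \<in> V" "u \<in> nbrs E w" "u' \<in> nbrs E w"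
    using simple_graph_edge[OF assms(1,3)] assms(3,4) by (auto simp: nbrs_def)
  then show ?thesis using rotation_cyclic[OF assms(2)] assms(5)
    by (metis cyclic_on_def bij_betw_def inj_onD)
qed

lemma finite_darts:
  assumes "simple_graph V E" shows "finite (darts E)"
proof -
  have "darts E \<subseteq> V \<times> V" using simple_graph_edge[OF assms] by (auto simp: darts_def)
  then show ?thesis using assms finite_subset by (auto simp: simple_graph_def)
qed

lemma face_step_bij:
  assumes "simple_graph V E" "rotation_system V E rot"
  shows "bij_betw (face_step rot) (darts E) (darts E)"
proof -
  have "inj_on (face_step rot) (darts E)"
    using rot_inj[OF assms] by (auto simp: inj_on_def face_step_def darts_def)
  moreover have "face_step rot ` darts E \<subseteq> darts E"
    using rot_edge[OF assms] by (auto simp: face_step_def darts_def insert_commute)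
  ultimately show ?thesis using endo_inj_surj[OF finite_darts[OF assms(1)]]
    by (auto simp: bij_betw_def)
qed

text \<open>No face is monochromatic iff no set is; unlike single faces, closed sets of darts are easily
  transferred when an operation on the graph merges or cuts faces.\<close>
definition monochromatic :: "'a set set \<Rightarrow> ('a \<Rightarrow> 'a \<Rightarrow> 'a) \<Rightarrow> ('a \<times> 'a \<Rightarrow> bool) \<Rightarrow> bool \<Rightarrow> ('a \<times> 'a) set \<Rightarrow> bool" where
  "monochromatic E rot L k S \<longleftrightarrow>
    S \<subseteq> darts E \<and> S \<noteq> {} \<and> face_step rot ` S \<subseteq> S \<and> (\<forall>d\<in>S. L d = k)"

text \<open>\<open>out u w\<close> means that the labels on the two sides of the edge \<open>uw\<close> differ at \<open>u\<close>.\<close>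
locale oriented_labeling =
  fixes V :: "'a set" and E :: "'a set set" and rot :: "'a \<Rightarrow> 'a \<Rightarrow> 'a" and s0 s1 :: 'a
    and out :: "'a \<Rightarrow> 'a \<Rightarrow> bool" and L :: "'a \<times> 'a \<Rightarrow> bool"
  assumes out_edge: "out u w \<Longrightarrow> {u, w} \<in> E"
    and out_xor: "{u, w} \<in> E \<Longrightarrow> {u, w} \<noteq> {s0, s1} \<Longrightarrow> out u w \<noteq> out w u"
    and out_s0: "\<not> out s0 u" and out_s1: "\<not> out s1 u"
    and out_card: "w \<in> V - {s0, s1} \<Longrightarrow> card {u. out w u} = 2"
    and switch: "{u, w} \<in> E \<Longrightarrow> (L (u, w) \<noteq> L (rot w u, w)) = out w (rot w u)"
    and L_s0: "{u, s0} \<in> E \<Longrightarrow> \<not> L (u, s0)" and L_s1: "{u, s1} \<in> E \<Longrightarrow> L (u, s1)"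
    and not_mono: "\<not> monochromatic E rot L k S"

locale embedded_graph =
  fixes V :: "'a set" and E :: "'a set set" and rot :: "'a \<Rightarrow> 'a \<Rightarrow> 'a"
  assumes simple: "simple_graph V E" and rots: "rotation_system V E rot"
begin

lemma step_darts: "d \<in> darts E \<Longrightarrow> face_step rot d \<in> darts E"
  using face_step_bij[OF simple rots] by (auto simp: bij_betw_def)

lemma mono_step: "monochromatic E rot L k S \<Longrightarrow> d \<in> S \<Longrightarrow> face_step rot d \<in> S"
  by (auto simp: monochromatic_def)

lemma mono_step_inv:
  "monochromatic E rot L k S \<Longrightarrow> d \<in> darts E \<Longrightarrow> face_step rot d \<in> S \<Longrightarrow> d \<in> S"
  using bij_betw_inv_closed[OF finite_darts[OF simple] face_step_bij[OF simple rots], of S d]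
  unfolding monochromatic_def by blast

lemma mono_label: "monochromatic E rot L k S \<Longrightarrow> d \<in> S \<Longrightarrow> L d = k"
  by (auto simp: monochromatic_def)

end

subsection \<open>Vertices of degree two\<close>

text \<open>\<open>pa\<close> and \<open>pb\<close> precede \<open>v\<close> in the rotations at
  \<open>a\<close> and \<open>b\<close>. The edge \<open>av\<close> separates the angles
  \<open>(pa, a)\<close> and \<open>(v, a)\<close>, which the removal of \<open>v\<close> merges
  into one angle, again named \<open>(pa, a)\<close>; likewise at \<open>b\<close>.\<close>

locale degree_2 = embedded_graph V E rot for V :: "'a set" and E rot +
  fixes v a b pa pb :: 'a
  assumes v: "v \<in> V" and nv: "nbrs E v = {a, b}" and ab: "a \<noteq> b"
    and pa: "{pa, a} \<in> E" "pa \<noteq> v" "rot a pa = v" "rot a v \<noteq> v"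
    and pb: "{pb, b} \<in> E" "pb \<noteq> v" "rot b pb = v" "rot b v \<noteq> v"
begin

definition "E' = {e \<in> E. v \<notin> e}"
definition "rot' w = skip v (rot w)"

lemma edges_v: "{a, v} \<in> E" "{b, v} \<in> E" "{v, a} \<in> E" "{v, b} \<in> E" "a \<noteq> v" "b \<noteq> v"
proof -
  show *: "{a, v} \<in> E" "{b, v} \<in> E" using nv by (auto simp: nbrs_def)
  then show "{v, a} \<in> E" "{v, b} \<in> E" "a \<noteq> v" "b \<noteq> v"
    using simple_graph_edge[OF simple] by (auto simp: insert_commute)
qed

lemma edge_v_iff: "{u, v} \<in> E \<longleftrightarrow> u = a \<or> u = b" "{v, u} \<in> E \<longleftrightarrow> u = a \<or> u = b"
  using nv by (auto simp: nbrs_def insert_commute)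

lemma rot_v: "rot v a = b" "rot v b = a"
proof -
  have "cyclic_on (rot v) {a, b}" using rotation_cyclic[OF rots v] nv by simp
  moreover have "card {a, b} \<ge> 2" using ab by simp
  ultimately have "rot v a \<noteq> a" "rot v b \<noteq> b" "rot v ` {a, b} = {a, b}"
    using cyclic_on_pred(2)[of "rot v" "{a, b}"] by (auto simp: cyclic_on_def bij_betw_def)
  then show "rot v a = b" "rot v b = a" by auto
qed

lemma rot_eq_v:
  assumes "{u, w} \<in> E" "rot w u = v"
  shows "(w = a \<and> u = pa) \<or> (w = b \<and> u = pb)"
proof -
  have "{v, w} \<in> E" using rot_edge[OF simple rots assms(1)] assms(2) by simp
  then have "w = a \<or> w = b" by (simp add: edge_v_iff)
  then show ?thesis
    using rot_inj[OF simple rots assms(1), of pa] rot_inj[OF simple rots assms(1), of pb] pa pb assms(2)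
    by metis
qed

lemma E'_iff: "{u, w} \<in> E' \<longleftrightarrow> {u, w} \<in> E \<and> u \<noteq> v \<and> w \<noteq> v" by (auto simp: E'_def)

lemma embedded': "embedded_graph (V - {v}) E' rot'"
proof
  show "simple_graph (V - {v}) E'" unfolding E'_def by (rule simple_graph_remove_vertex[OF simple])
  have "nbrs E' w = nbrs E w - {v}" if "w \<noteq> v" for w using that by (auto simp: nbrs_def E'_iff)
  then show "rotation_system (V - {v}) E' rot'"
    using cyclic_on_skip[OF rotation_cyclic[OF rots]] by (auto simp: rotation_system_def rot'_def)
qed

lemma steps: "face_step rot (pa, a) = (a, v)" "face_step rot (a, v) = (v, b)"
   "face_step rot (pb, b) = (b, v)" "face_step rot (b, v) = (v, a)"
  using pa(3) pb(3) rot_v by (simp_all add: face_step_def)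

text \<open>Removing \<open>v\<close> alters the face traversal only after \<open>(pa, a)\<close>
  and \<open>(pb, b)\<close>, where it continues as the original one does after
  \<open>(v, a)\<close> and \<open>(v, b)\<close>. The last two hypotheses cover exactly these
  places.\<close>

lemma closed_restrict:
  assumes T: "T \<subseteq> darts E" "face_step rot ` T \<subseteq> T"
    and A: "(pa, a) \<in> T \<Longrightarrow> (v, a) \<in> T" and B: "(pb, b) \<in> T \<Longrightarrow> (v, b) \<in> T"
  shows "face_step rot' ` (T \<inter> darts E') \<subseteq> T \<inter> darts E'"
proof (rule image_subsetI)
  fix d assume d: "d \<in> T \<inter> darts E'"
  obtain u w where uw: "d = (u, w)" by force
  have e: "{u, w} \<in> E" "w \<noteq> v" "u \<noteq> v" using d uw by (auto simp: darts_def E'_iff)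
  have in': "face_step rot' d \<in> darts E'" using embedded_graph.step_darts[OF embedded'] d by auto
  have "face_step rot' d \<in> T"
  proof (cases "rot w u = v")
    case True
    then consider "w = a" "u = pa" | "w = b" "u = pb" using rot_eq_v[OF e(1)] by auto
    then show ?thesis
    proof cases
      case 1
      then have "face_step rot' d = face_step rot (v, a)"
        using uw pa by (simp add: face_step_def rot'_def skip_def)
      then show ?thesis using T A 1 d uw by auto
    next
      case 2
      then have "face_step rot' d = face_step rot (v, b)"
        using uw pb by (simp add: face_step_def rot'_def skip_def)
      then show ?thesis using T B 2 d uw by auto
    qed
  next
    case False
    then have "face_step rot' d = face_step rot d"
      using uw by (simp add: face_step_def rot'_def skip_def)
    then show ?thesis using T d by auto
  qed
  then show "face_step rot' d \<in> T \<inter> darts E'" using in' by simp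
qed

text \<open>Both edges at \<open>v\<close> are to leave it, so its two angles get opposite labels
  and \<open>z\<close> is the only free bit. The two halves of a merged angle at \<open>a\<close> or
  \<open>b\<close> share its label.\<close>

definition "lab L' z = (\<lambda>(u, w). if w = v then (if u = a then z else \<not> z)
   else if u = v then (if w = a then L' (pa, a) else L' (pb, b)) else L' (u, w))"

lemma lab_restrict: "d \<in> darts E' \<Longrightarrow> lab L' z d = L' d"
  by (auto simp: lab_def darts_def E'_iff)

lemma lab_values: "lab L' z (a, v) = z" "lab L' z (b, v) = (\<not> z)"
  "lab L' z (v, a) = L' (pa, a)" "lab L' z (v, b) = L' (pb, b)"
  "lab L' z (pa, a) = L' (pa, a)" "lab L' z (pb, b) = L' (pb, b)"
  using edges_v(5,6) ab pa(2) pb(2) by (simp_all add: lab_def)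

lemma darts_special: "(a, v) \<in> darts E" "(b, v) \<in> darts E" "(pa, a) \<in> darts E" "(pb, b) \<in> darts E"
  using edges_v pa(1) pb(1) by (simp_all add: darts_def)

text \<open>A set that passes through \<open>v\<close> in neither direction would survive the
  removal of \<open>v\<close> and contradict \<open>nm\<close>. A passage from \<open>a\<close> to
  \<open>b\<close> forces \<open>z = k\<close>, one from \<open>b\<close> to \<open>a\<close> the
  opposite, and either fixes the labels of both merged angles.\<close>

lemma mono_cases:
  assumes nm: "\<And>k S. \<not> monochromatic E' rot' L' k S" and m: "monochromatic E rot (lab L' z) k S"
  shows "((pa, a) \<in> S \<and> (v, b) \<in> S \<and> L' (pa, a) = k \<and> L' (pb, b) = k \<and> z = k) \<or>
    ((pb, b) \<in> S \<and> (v, a) \<in> S \<and> L' (pa, a) = k \<and> L' (pb, b) = k \<and> z = (\<not> k))"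
proof -
  note inv = mono_step_inv[OF m] and fwd = mono_step[OF m] and val = mono_label[OF m]
  have a: ?thesis if "(a, v) \<in> S"
    using inv[OF darts_special(3)] fwd[OF that] that val[of "(a, v)"] val[of "(pa, a)"] val[of "(v, b)"]
    by (simp add: steps lab_values)
  have b: ?thesis if "(b, v) \<in> S"
    using inv[OF darts_special(4)] fwd[OF that] that val[of "(b, v)"] val[of "(pb, b)"] val[of "(v, a)"]
    by (auto simp add: steps lab_values)
  have "False" if n: "(a, v) \<notin> S" "(b, v) \<notin> S"
  proof -
    have n2: "(v, a) \<notin> S" "(v, b) \<notin> S" using inv[OF darts_special(1)] inv[OF darts_special(2)] n
      by (auto simp: steps)
    have n3: "(pa, a) \<notin> S" "(pb, b) \<notin> S" using fwd[of "(pa, a)"] fwd[of "(pb, b)"] n by (auto simp: steps)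
    have sub: "S \<subseteq> darts E" "face_step rot ` S \<subseteq> S" "S \<noteq> {}" using m by (auto simp: monochromatic_def)
    then have "S \<inter> darts E' = S" using n n2 by (auto simp: darts_def E'_iff edge_v_iff)
    then have "monochromatic E' rot' L' k S"
      using closed_restrict[OF sub(1,2)] n3 sub val lab_restrict unfolding monochromatic_def by (metis Int_iff subsetI)
    then show False using nm by blast
  qed
  then show ?thesis using a b by blast
qed

text \<open>If both bits fail, the two monochromatic sets have the same colour and pass
  \<open>v\<close> in opposite directions. Each supplies the dart at which the other is cut, so
  their union restricts to a closed set of the smaller graph.\<close>

lemma extend_faces:
  assumes nm: "\<And>k S. \<not> monochromatic E' rot' L' k S"
  shows "\<exists>z. \<forall>k S. \<not> monochromatic E rot (lab L' z) k S"
proof (rule ccontr)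
  assume no: "\<not> ?thesis"
  \<comment> \<open>Either failure forces the colour of the set to be the label of
    \<open>(pa, a)\<close>; naming it first tells which bit belongs to which direction.\<close>
  define k where "k = L' (pa, a)"
  obtain k1 S1 where m1: "monochromatic E rot (lab L' k) k1 S1" using no by blast
  obtain k2 S2 where m2: "monochromatic E rot (lab L' (\<not> k)) k2 S2" using no by blast
  have 1: "(pa, a) \<in> S1" "(v, b) \<in> S1" "k1 = k" using mono_cases[OF nm m1] by (auto simp: k_def)
  have 2: "(pb, b) \<in> S2" "(v, a) \<in> S2" "k2 = k" using mono_cases[OF nm m2] by (auto simp: k_def)
  let ?T = "S1 \<union> S2"
  have "face_step rot' ` (?T \<inter> darts E') \<subseteq> ?T \<inter> darts E'"
    by (rule closed_restrict) (use m1 m2 1 2 in \<open>auto simp: monochromatic_def\<close>)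
  moreover have "(pa, a) \<in> ?T \<inter> darts E'" using 1 pa edges_v by (auto simp: darts_def E'_iff)
  moreover have "L' d = k" if "d \<in> ?T \<inter> darts E'" for d
    using that lab_restrict[of d] mono_label[OF m1, of d] mono_label[OF m2, of d] 1 2 by auto
  ultimately have "monochromatic E' rot' L' k (?T \<inter> darts E')" by (auto simp: monochromatic_def)
  then show False using nm by blast
qed

lemma extend_labeling:
  assumes s: "v \<noteq> s0" "v \<noteq> s1"
    and o': "oriented_labeling (V - {v}) E' rot' s0 s1 out' L'"
  shows "\<exists>out L. oriented_labeling V E rot s0 s1 out L"
proof -
  interpret o: oriented_labeling "V - {v}" E' rot' s0 s1 out' L' by (rule o')
  obtain z where z: "\<And>k S. \<not> monochromatic E rot (lab L' z) k S"
    using extend_faces[OF o.not_mono] by blast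
  \<comment> \<open>\<open>v\<close> gets out-degree 2 and no other vertex gains an outgoing
    edge.\<close>
  define out where "out x y \<longleftrightarrow> out' x y \<or> (x = v \<and> (y = a \<or> y = b))" for x y
  have nv': "\<not> out' x v" "\<not> out' v x" for x using o.out_edge[of x v] o.out_edge[of v x] by (auto simp: E'_iff)
  have pE: "{pa, a} \<in> E'" "{pb, b} \<in> E'" using pa pb edges_v by (auto simp: E'_iff)
  have "oriented_labeling V E rot s0 s1 out (lab L' z)"
  proof
    show "{u, w} \<in> E" if "out u w" for u w
      using that o.out_edge[of u w] edges_v by (auto simp: out_def E'_iff)
    show "out u w \<noteq> out w u" if e: "{u, w} \<in> E" "{u, w} \<noteq> {s0, s1}" for u w
    proof (cases "u = v \<or> w = v")
      case True
      then show ?thesis using e nv' edges_v by (auto simp: out_def edge_v_iff)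
    next
      case False
      then show ?thesis using o.out_xor[of u w] e by (auto simp: out_def E'_iff)
    qed
    show "\<not> out s0 u" "\<not> out s1 u" for u using s o.out_s0 o.out_s1 by (auto simp: out_def)
    show "card {u. out w u} = 2" if w: "w \<in> V - {s0, s1}" for w
    proof (cases "w = v")
      case True
      then have "{u. out w u} = {a, b}" using nv' by (auto simp: out_def)
      then show ?thesis using ab by simp
    next
      case False
      then show ?thesis using o.out_card[of w] w by (simp add: out_def)
    qed
    show "\<not> lab L' z (u, s0)" if "{u, s0} \<in> E" for u
      using o.L_s0[of u] o.L_s0[of pa] o.L_s0[of pb] pE that s by (auto simp: lab_def E'_iff edge_v_iff)
    show "lab L' z (u, s1)" if "{u, s1} \<in> E" for u
      using o.L_s1[of u] o.L_s1[of pa] o.L_s1[of pb] pE that s by (auto simp: lab_def E'_iff edge_v_iff)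
    show "(lab L' z (u, w) \<noteq> lab L' z (rot w u, w)) = out w (rot w u)" if e: "{u, w} \<in> E" for u w
    proof (cases "w = v")
      case True
      then have "u = a \<or> u = b" using e by (simp add: edge_v_iff)
      then show ?thesis by (rule disjE) (simp_all add: True rot_v lab_values out_def)
    next
      case wv: False
      show ?thesis
      proof (cases "u = v")
        case True
        then have "w = a \<or> w = b" using e by (simp add: edge_v_iff)
        then consider "w = a" | "w = b" by blast
        then show ?thesis
        proof cases
          case 1
          \<comment> \<open>\<open>(v, a)\<close> is the second half of the angle
            \<open>(pa, a)\<close> of the smaller graph, so the change after it is the one that
            \<open>rot'\<close> sees after \<open>pa\<close>. The case of \<open>b\<close> is the
            same.\<close>
          have "lab L' z (rot a v, a) = L' (rot a v, a)" using pa edges_v by (simp add: lab_def)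
          then show ?thesis using o.switch[OF pE(1)] 1 True pa edges_v wv
            by (simp add: lab_values rot'_def skip_def out_def)
        next
          case 2
          have "lab L' z (rot b v, b) = L' (rot b v, b)" using pb edges_v by (simp add: lab_def)
          then show ?thesis using o.switch[OF pE(2)] 2 True pb edges_v wv
            by (simp add: lab_values rot'_def skip_def out_def)
        qed
      next
        case uv: False
        then have e': "{u, w} \<in> E'" using e wv by (simp add: E'_iff)
        show ?thesis
        proof (cases "rot w u = v")
          case True
          then show ?thesis using rot_eq_v[OF e True] wv
            by (elim disjE conjE) (simp_all add: lab_values out_def nv')
        next
          case False
          then have "rot' w u = rot w u" by (simp add: rot'_def skip_def)
          then show ?thesis using o.switch[OF e'] uv wv False by (simp add: lab_def out_def)
        qed
      qed
    qed
    show "\<not> monochromatic E rot (lab L' z) k S" for k S by (rule z)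
  qed
  then show ?thesis by blast
qed

end

subsection \<open>Vertices of degree three\<close>

text \<open>The new edge \<open>ab\<close> replaces the path \<open>avb\<close>, and
  \<open>c\<close> loses its edge to \<open>v\<close>. With the rotation fixed as \<open>b\<close>,
  \<open>a\<close>, \<open>c\<close>, the edge \<open>vc\<close> lies on one side of this path:
  faces pass \<open>bva\<close> on the one side, and \<open>avc\<close> and \<open>cvb\<close> on
  the other.\<close>

locale degree_3 = embedded_graph V E rot for V :: "'a set" and E rot +
  fixes v a b c pa pb pc :: 'a
  assumes v: "v \<in> V" and nv: "nbrs E v = {a, b, c}" and abc: "a \<noteq> b" "b \<noteq> c" "a \<noteq> c"
    and nab: "{a, b} \<notin> E"
    and rot_v: "rot v b = a" "rot v a = c" "rot v c = b"
    and pa: "{pa, a} \<in> E" "pa \<noteq> v" "rot a pa = v" "rot a v \<noteq> v"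
    and pb: "{pb, b} \<in> E" "pb \<noteq> v" "rot b pb = v" "rot b v \<noteq> v"
    and pc: "{pc, c} \<in> E" "pc \<noteq> v" "rot c pc = v" "rot c v \<noteq> v"
begin

definition "E' = insert {a, b} {e \<in> E. v \<notin> e}"
text \<open>Drawing \<open>ab\<close> along \<open>avb\<close> puts it into the slots that
  \<open>av\<close> and \<open>bv\<close> had at \<open>a\<close> and \<open>b\<close>.\<close>

definition "rot' w = (if w = a then replace v b (rot a) else if w = b then replace v a (rot b)
  else skip v (rot w))"

lemma edges_v: "{a, v} \<in> E" "{b, v} \<in> E" "{c, v} \<in> E" "{v, a} \<in> E" "{v, b} \<in> E" "{v, c} \<in> E"
  and neq_v: "a \<noteq> v" "b \<noteq> v" "c \<noteq> v"
proof -
  show *: "{a, v} \<in> E" "{b, v} \<in> E" "{c, v} \<in> E" using nv by (auto simp: nbrs_def)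
  then show "{v, a} \<in> E" "{v, b} \<in> E" "{v, c} \<in> E" by (simp_all add: insert_commute)
  show "a \<noteq> v" "b \<noteq> v" "c \<noteq> v" using simple_graph_edge(1)[OF simple] * by blast+
qed

lemma nba: "{b, a} \<notin> E" using nab by (simp add: insert_commute)

lemma edge_v_iff: "{u, v} \<in> E \<longleftrightarrow> u = a \<or> u = b \<or> u = c" "{v, u} \<in> E \<longleftrightarrow> u = a \<or> u = b \<or> u = c"
  using nv by (auto simp: nbrs_def insert_commute)

lemma rot_eq_v:
  assumes "{u, w} \<in> E" "rot w u = v"
  shows "(w = a \<and> u = pa) \<or> (w = b \<and> u = pb) \<or> (w = c \<and> u = pc)"
proof -
  have "{v, w} \<in> E" using rot_edge[OF simple rots assms(1)] assms(2) by simp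
  then have "w = a \<or> w = b \<or> w = c" by (simp add: edge_v_iff)
  then show ?thesis
    using rot_inj[OF simple rots assms(1), of pa] rot_inj[OF simple rots assms(1), of pb]
      rot_inj[OF simple rots assms(1), of pc] pa pb pc assms(2)
    by metis
qed

lemma E'_iff: "{u, w} \<in> E' \<longleftrightarrow> {u, w} = {a, b} \<or> ({u, w} \<in> E \<and> u \<noteq> v \<and> w \<noteq> v)"
  by (auto simp: E'_def)

lemma in_E': "{u, w} \<in> E \<Longrightarrow> u \<noteq> v \<Longrightarrow> w \<noteq> v \<Longrightarrow> {u, w} \<in> E'"
  by (simp add: E'_iff)

lemma special_E': "{a, b} \<in> E'" "{b, a} \<in> E'" "{pa, a} \<in> E'" "{pb, b} \<in> E'" "{pc, c} \<in> E'"
proof -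
  show "{a, b} \<in> E'" "{b, a} \<in> E'" by (simp_all add: E'_def insert_commute)
  show "{pa, a} \<in> E'" by (rule in_E'[OF pa(1,2) neq_v(1)])
  show "{pb, b} \<in> E'" by (rule in_E'[OF pb(1,2) neq_v(2)])
  show "{pc, c} \<in> E'" by (rule in_E'[OF pc(1,2) neq_v(3)])
qed

lemma p_neq: "pa \<noteq> b" "pb \<noteq> a"
  using pa(1) pb(1) nab nba by metis+

lemma rot'_values:
  "rot' a b = rot a v" "rot' b a = rot b v" "rot' a pa = b" "rot' b pb = a" "rot' c pc = rot c v"
  using pa(3,4) pb(3,4) pc(3) abc p_neq by (simp_all add: rot'_def replace_def skip_def Let_def)

lemma rot'_same:
  assumes "{u, w} \<in> E" "rot w u \<noteq> v"
  shows "rot' w u = rot w u"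
proof -
  have "w = a \<Longrightarrow> u \<noteq> b" "w = b \<Longrightarrow> u \<noteq> a" using assms(1) nab nba by metis+
  then show ?thesis using assms(2) abc(1)
    by (cases "w = a"; cases "w = b") (simp_all add: rot'_def replace_def skip_def Let_def)
qed

lemma embedded': "embedded_graph (V - {v}) E' rot'"
proof
  have V: "a \<in> V" "b \<in> V" using edges_v simple_graph_edge[OF simple] by blast+
  then show "simple_graph (V - {v}) E'"
    using simple_graph_remove_vertex[OF simple, of v] abc neq_v unfolding E'_def simple_graph_def
    by blast
  have na: "nbrs E' a = insert b (nbrs E a - {v})" "nbrs E' b = insert a (nbrs E b - {v})"
    using neq_v abc by (auto simp: nbrs_def E'_iff doubleton_eq_iff)
  have nw: "nbrs E' w = nbrs E w - {v}" if "w \<noteq> v" "w \<noteq> a" "w \<noteq> b" for w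
    using that by (auto simp: nbrs_def E'_iff doubleton_eq_iff)
  have ca: "cyclic_on (rot' a) (nbrs E' a)"
    unfolding na rot'_def using cyclic_on_replace[OF rotation_cyclic[OF rots V(1)], of v b] edges_v nba
    by (simp add: nbrs_def)
  have cb: "cyclic_on (rot' b) (nbrs E' b)"
    unfolding na rot'_def using cyclic_on_replace[OF rotation_cyclic[OF rots V(2)], of v a] edges_v nab abc
    by (simp add: nbrs_def)
  show "rotation_system (V - {v}) E' rot'"
    unfolding rotation_system_def
  proof
    fix w assume w: "w \<in> V - {v}"
    show "cyclic_on (rot' w) (nbrs E' w)"
    proof (cases "w = a \<or> w = b")
      case True then show ?thesis using ca cb by blast
    next
      case False
      then show ?thesis using nw[of w] w cyclic_on_skip[OF rotation_cyclic[OF rots], of w v]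
        by (simp add: rot'_def)
    qed
  qed
qed

lemma steps: "face_step rot (pa, a) = (a, v)" "face_step rot (a, v) = (v, c)"
   "face_step rot (pb, b) = (b, v)" "face_step rot (b, v) = (v, a)"
   "face_step rot (pc, c) = (c, v)" "face_step rot (c, v) = (v, b)"
  using pa(3) pb(3) pc(3) rot_v by (simp_all add: face_step_def)

text \<open>A dart names an angle at its head. The angle named by the new dart \<open>(a, b)\<close>
  is the one named by \<open>(v, b)\<close> in the larger graph, since
  \<open>rot' b a = rot b v\<close>; likewise for \<open>(b, a)\<close>.\<close>

definition lift :: "'a \<times> 'a \<Rightarrow> 'a \<times> 'a" where
  "lift d = (if d = (a, b) then (v, b) else if d = (b, a) then (v, a) else d)"

lemma lift_same: "{u, w} \<in> E \<Longrightarrow> lift (u, w) = (u, w)"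
proof -
  assume "{u, w} \<in> E"
  then have "(u, w) \<noteq> (a, b)" "(u, w) \<noteq> (b, a)" using nab nba by blast+
  then show ?thesis unfolding lift_def by (metis (full_types))
qed

lemma lift_ab: "lift (a, b) = (v, b)" "lift (b, a) = (v, a)"
  using abc by (auto simp: lift_def)

text \<open>The passage \<open>bva\<close> merely subdivides the dart \<open>(b, a)\<close> and
  needs no hypothesis. The traversals really differ only after \<open>(pa, a)\<close>, where the
  detour to \<open>c\<close> is cut off, and after \<open>(pc, c)\<close>, where the edge
  \<open>cv\<close> is skipped; the last two hypotheses bridge these gaps.\<close>

lemma closed_lift:
  assumes T: "T \<subseteq> darts E" "face_step rot ` T \<subseteq> T"
    and A: "(pa, a) \<in> T \<Longrightarrow> (v, b) \<in> T" and C: "(pc, c) \<in> T \<Longrightarrow> (v, c) \<in> T"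
  shows "face_step rot' ` {d \<in> darts E'. lift d \<in> T} \<subseteq> {d \<in> darts E'. lift d \<in> T}"
proof (rule image_subsetI)
  fix d assume d: "d \<in> {d \<in> darts E'. lift d \<in> T}"
  have step: "face_step rot x \<in> T" if "x \<in> T" for x using T that by blast
  have lift_rot: "lift (w, rot w u) = (w, rot w u)" if "{u, w} \<in> E" for u w
    using lift_same[of w "rot w u"] rot_edge[OF simple rots that] by (simp add: insert_commute)
  obtain u w where uw: "d = (u, w)" by force
  have e: "{u, w} \<in> E'" using d uw by (simp add: darts_def)
  have "lift (w, rot' w u) \<in> T"
  proof (cases "{u, w} = {a, b}")
    case True
    then consider "u = a" "w = b" | "u = b" "w = a" by (auto simp: doubleton_eq_iff)
    then show ?thesis
    proof cases
      case 1
      then have "face_step rot (v, b) \<in> T" using step d uw by (simp add: lift_ab)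
      then show ?thesis using 1 lift_rot[OF edges_v(5)] by (simp add: face_step_def rot'_values)
    next
      case 2
      then have "face_step rot (v, a) \<in> T" using step d uw by (simp add: lift_ab)
      then show ?thesis using 2 lift_rot[OF edges_v(4)] by (simp add: face_step_def rot'_values)
    qed
  next
    case False
    then have eE: "{u, w} \<in> E" "u \<noteq> v" "w \<noteq> v" using e by (auto simp: E'_iff)
    then have dT: "(u, w) \<in> T" using d uw lift_same by simp
    show ?thesis
    proof (cases "rot w u = v")
      case True
      then consider "w = a" "u = pa" | "w = b" "u = pb" | "w = c" "u = pc" using rot_eq_v[OF eE(1)] by blast
      then show ?thesis
      proof cases
        case 1 then show ?thesis using A dT by (simp add: rot'_values lift_ab)
      next
        case 2
        \<comment> \<open>One step of the smaller graph onto \<open>(b, a)\<close> corresponds to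
          the two steps through \<open>(b, v)\<close> to \<open>(v, a)\<close>.\<close>
        then have "face_step rot (face_step rot (pb, b)) \<in> T" using step dT by blast
        then show ?thesis using 2 by (simp add: rot'_values lift_ab steps)
      next
        case 3
        then have "face_step rot (v, c) \<in> T" using C step dT by blast
        then show ?thesis using 3 lift_rot[OF edges_v(6)] by (simp add: rot'_values face_step_def)
      qed
    next
      case False
      then show ?thesis using step[OF dT] lift_rot[OF eE(1)] rot'_same[OF eE(1)]
        by (simp add: face_step_def)
    qed
  qed
  moreover have "face_step rot' d \<in> darts E'" using embedded_graph.step_darts[OF embedded'] d by auto
  ultimately show "face_step rot' d \<in> {d \<in> darts E'. lift d \<in> T}" using uw by (simp add: face_step_def)
qed

text \<open>Opposite labels on both sides of \<open>vc\<close> at \<open>v\<close> make this edge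
  leave \<open>v\<close>; the third label \<open>y\<close> then decides which of \<open>va\<close>
  and \<open>vb\<close> is the other outgoing edge. At \<open>a\<close>, \<open>b\<close> and
  \<open>c\<close> the edge to \<open>v\<close> leaves the labels of the smaller graph in
  place.\<close>

definition "lab L' z y = (\<lambda>(u, w). if w = v then (if u = a then z else if u = c then \<not> z else y)
   else if u = v then (if w = a then L' (b, a) else if w = b then L' (a, b) else L' (pc, c))
   else L' (u, w))"

lemma lab_values: "lab L' z y (a, v) = z" "lab L' z y (b, v) = y" "lab L' z y (c, v) = (\<not> z)"
  "lab L' z y (v, a) = L' (b, a)" "lab L' z y (v, b) = L' (a, b)" "lab L' z y (v, c) = L' (pc, c)"
  using neq_v abc by (simp_all add: lab_def)

lemma lab_same: "u \<noteq> v \<Longrightarrow> w \<noteq> v \<Longrightarrow> lab L' z y (u, w) = L' (u, w)"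
  by (simp add: lab_def)

lemma lab_lift: "d \<in> darts E' \<Longrightarrow> lab L' z y (lift d) = L' d"
proof -
  assume d: "d \<in> darts E'"
  obtain u w where uw: "d = (u, w)" by force
  show ?thesis
  proof (cases "{u, w} = {a, b}")
    case True
    then show ?thesis using uw by (auto simp: doubleton_eq_iff lift_ab lab_values)
  next
    case False
    then have "{u, w} \<in> E" "u \<noteq> v" "w \<noteq> v" using d uw by (auto simp: E'_iff darts_def)
    then show ?thesis using uw lift_same lab_same by simp
  qed
qed

lemma darts_special: "(a, v) \<in> darts E" "(b, v) \<in> darts E" "(c, v) \<in> darts E"
   "(pa, a) \<in> darts E" "(pb, b) \<in> darts E" "(pc, c) \<in> darts E"
  using edges_v pa(1) pb(1) pc(1) by (simp_all add: darts_def)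

lemma darts_special': "(a, b) \<in> darts E'" "(b, a) \<in> darts E'" "(pa, a) \<in> darts E'"
  using special_E' by (simp_all add: darts_def)

text \<open>A set without the passages \<open>avc\<close> and \<open>cvb\<close> could be pulled
  back along \<open>lift\<close>, contradicting \<open>nm\<close>. The first passage forces
  \<open>z = k\<close>, the second the opposite, whatever \<open>y\<close> is.\<close>

lemma mono_cases:
  assumes nm: "\<And>k S. \<not> monochromatic E' rot' L' k S" and m: "monochromatic E rot (lab L' z y) k S"
  shows "((pa, a) \<in> S \<and> (v, c) \<in> S \<and> L' (pa, a) = k \<and> z = k) \<or>
    ((pc, c) \<in> S \<and> (v, b) \<in> S \<and> L' (a, b) = k \<and> z = (\<not> k))"
proof -
  note inv = mono_step_inv[OF m] and fwd = mono_step[OF m] and val = mono_label[OF m]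
  have a: ?thesis if "(a, v) \<in> S"
    using inv[OF darts_special(4)] fwd[OF that] that val[of "(a, v)"] val[of "(pa, a)"]
    by (simp add: steps lab_values lab_same neq_v pa(2))
  have c: ?thesis if "(c, v) \<in> S"
    using inv[OF darts_special(6)] fwd[OF that] that val[of "(c, v)"] val[of "(v, b)"]
    by (auto simp add: steps lab_values)
  have "False" if n: "(a, v) \<notin> S" "(c, v) \<notin> S"
  proof -
    have n2: "(v, c) \<notin> S" "(v, b) \<notin> S" using inv[OF darts_special(1)] inv[OF darts_special(3)] n
      by (auto simp: steps)
    have n3: "(pa, a) \<notin> S" "(pc, c) \<notin> S" using fwd[of "(pa, a)"] fwd[of "(pc, c)"] n by (auto simp: steps)
    have sub: "S \<subseteq> darts E" "face_step rot ` S \<subseteq> S" "S \<noteq> {}" using m by (auto simp: monochromatic_def)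
    let ?S = "{d \<in> darts E'. lift d \<in> S}"
    have "face_step rot' ` ?S \<subseteq> ?S" using closed_lift[OF sub(1,2)] n3 by blast
    moreover have "?S \<noteq> {}"
    proof -
      obtain u w where d: "(u, w) \<in> S" using sub(3) by auto
      then have e: "{u, w} \<in> E" using sub(1) by (auto simp: darts_def)
      show ?thesis
      proof (cases "u = v \<or> w = v")
        case True
        \<comment> \<open>Of the darts at \<open>v\<close>, only those of the passage
          \<open>bva\<close> remain, and the second of them is the lift of
          \<open>(b, a)\<close>.\<close>
        then have "(b, v) \<in> S \<or> (v, a) \<in> S" using d e n n2 by (auto simp: edge_v_iff)
        then have "(v, a) \<in> S" using fwd[of "(b, v)"] by (auto simp: steps)
        then have "(b, a) \<in> ?S" using darts_special' by (simp add: lift_ab)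
        then show ?thesis by blast
      next
        case False
        then have "(u, w) \<in> ?S" using d e in_E' lift_same by (simp add: darts_def)
        then show ?thesis by blast
      qed
    qed
    moreover have "\<forall>d\<in>?S. L' d = k" using val lab_lift[of _ L' z y] by blast
    ultimately have "monochromatic E' rot' L' k ?S" unfolding monochromatic_def by blast
    then show False using nm by blast
  qed
  then show ?thesis using a c by blast
qed

text \<open>\<open>y\<close> may depend on \<open>z\<close> because \<open>mono_cases\<close> holds
  for every \<open>y\<close>. If both bits fail, one set passes \<open>avc\<close> and the other
  \<open>cvb\<close> in the same colour; together they bridge both gaps in
  \<open>closed_lift\<close>.\<close>

lemma extend_faces:
  assumes nm: "\<And>k S. \<not> monochromatic E' rot' L' k S"
  shows "\<exists>z. \<forall>k S. \<not> monochromatic E rot (lab L' z (y z)) k S"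
proof (rule ccontr)
  assume no: "\<not> ?thesis"
  \<comment> \<open>With \<open>z\<close> equal to the label of \<open>(a, b)\<close>, the second
    alternative of \<open>mono_cases\<close> is impossible.\<close>
  define k where "k = L' (a, b)"
  obtain k1 S1 where m1: "monochromatic E rot (lab L' k (y k)) k1 S1" using no by blast
  obtain k2 S2 where m2: "monochromatic E rot (lab L' (\<not> k) (y (\<not> k))) k2 S2" using no by blast
  have 1: "(pa, a) \<in> S1" "(v, c) \<in> S1" "k1 = k" "L' (pa, a) = k"
    using mono_cases[OF nm m1] by (auto simp: k_def)
  \<comment> \<open>The label of \<open>(pa, a)\<close> found for the first bit excludes the first
    alternative for the opposite bit.\<close>
  have 2: "(pc, c) \<in> S2" "(v, b) \<in> S2" "k2 = k"
    using mono_cases[OF nm m2] 1 by (auto simp: k_def)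
  let ?T = "S1 \<union> S2"
  let ?S = "{d \<in> darts E'. lift d \<in> ?T}"
  have "face_step rot' ` ?S \<subseteq> ?S"
  proof (rule closed_lift)
    show "?T \<subseteq> darts E" "face_step rot ` ?T \<subseteq> ?T"
      using m1 m2 unfolding monochromatic_def by blast+
  qed (use 1 2 in blast)+
  moreover have "(pa, a) \<in> ?S" using 1 darts_special' lift_same[OF pa(1)] by simp
  moreover have "L' d = k" if "d \<in> ?S" for d
    using that lab_lift[of d] mono_label[OF m1, of "lift d"] mono_label[OF m2, of "lift d"] 1 2 by auto
  ultimately have "monochromatic E' rot' L' k ?S" unfolding monochromatic_def by blast
  then show False using nm by blast
qed

lemma extend_labeling:
  assumes s: "v \<noteq> s0" "v \<noteq> s1" "{s0, s1} \<in> E"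
    and o': "oriented_labeling (V - {v}) E' rot' s0 s1 out' L'"
  shows "\<exists>out L. oriented_labeling V E rot s0 s1 out L"
proof -
  interpret o: oriented_labeling "V - {v}" E' rot' s0 s1 out' L' by (rule o')
  \<comment> \<open>This value of \<open>y\<close> equals \<open>z\<close> exactly when
    \<open>out' a b\<close>, which is when \<open>vb\<close> has to leave \<open>v\<close>.\<close>
  obtain z where z: "\<And>k S. \<not> monochromatic E rot (lab L' z (z = out' a b)) k S"
    using extend_faces[OF o.not_mono, of "\<lambda>z. z = out' a b"] by blast
  let ?L = "lab L' z (z = out' a b)"
  \<comment> \<open>The path \<open>avb\<close> inherits the direction of the edge
    \<open>ab\<close>, and \<open>vc\<close> leaves \<open>v\<close>; so \<open>v\<close> has
    out-degree 2.\<close>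
  define out where "out x y \<longleftrightarrow>
    (if x = v then y = c \<or> (y = b \<and> out' a b) \<or> (y = a \<and> out' b a)
     else if y = v then (x = a \<and> out' a b) \<or> (x = b \<and> out' b a)
     else out' x y \<and> {x, y} \<noteq> {a, b})" for x y
  have "{a, b} \<noteq> {s0, s1}" using s(3) nab by metis
  then have xor: "out' b a \<longleftrightarrow> \<not> out' a b" using o.out_xor[OF special_E'(1)] by blast
  have nv': "\<not> out' x v" "\<not> out' v x" for x
    using o.out_edge[of x v] o.out_edge[of v x] neq_v by (auto simp: E'_iff doubleton_eq_iff)
  have outE: "{x, y} \<in> E" if "out' x y" "{x, y} \<noteq> {a, b}" for x y
    using o.out_edge[OF that(1)] that(2) by (simp add: E'_iff)
  have "oriented_labeling V E rot s0 s1 out ?L"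
  proof
    show "{u, w} \<in> E" if "out u w" for u w
      using that outE[of u w] edges_v by (auto simp: out_def split: if_splits)
    show "out u w \<noteq> out w u" if e: "{u, w} \<in> E" "{u, w} \<noteq> {s0, s1}" for u w
    proof (cases "u = v \<or> w = v")
      case True
      then have "(u = v \<and> (w = a \<or> w = b \<or> w = c)) \<or> (w = v \<and> (u = a \<or> u = b \<or> u = c))"
        using e(1) by (elim disjE) (simp_all add: edge_v_iff)
      then show ?thesis using xor neq_v abc
        by (elim disjE conjE) (simp_all add: out_def neq_v[symmetric])
    next
      case False
      have "{u, w} \<noteq> {a, b}" "{w, u} \<noteq> {a, b}" using e(1) nab by (metis insert_commute)+
      moreover have "out' u w \<noteq> out' w u" using o.out_xor[OF in_E'[OF e(1)]] e(2) False by blast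
      ultimately show ?thesis using False by (simp add: out_def)
    qed
    show "\<not> out s0 u" "\<not> out s1 u" for u using s o.out_s0 o.out_s1 by (auto simp: out_def)
    show "card {u. out w u} = 2" if w: "w \<in> V - {s0, s1}" for w
    proof (cases "w = v")
      case True
      have "{u. out v u} = (if out' a b then {b, c} else {a, c})"
        using xor by (auto simp: out_def)
      then show ?thesis using True abc by (simp split: if_splits)
    next
      case False
      \<comment> \<open>At a vertex other than \<open>v\<close>, an outgoing edge \<open>ab\<close>
        is redirected to \<open>v\<close> and nothing else changes, so the out-degree is
        kept.\<close>
      let ?t = "\<lambda>u. if {w, u} = {a, b} then v else u"
      have "{u. out w u} = ?t ` {u. out' w u}"
      proof (rule set_eqI)
        fix u
        have t: "(\<exists>x. out' w x \<and> {w, x} = {a, b}) \<longleftrightarrow> (w = a \<and> out' a b) \<or> (w = b \<and> out' b a)"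
          using abc(1) by (metis doubleton_eq_iff)
        show "u \<in> {u. out w u} \<longleftrightarrow> u \<in> ?t ` {u. out' w u}"
        proof (cases "u = v")
          case True
          then have "u \<in> ?t ` {u. out' w u} \<longleftrightarrow> (\<exists>x. out' w x \<and> {w, x} = {a, b})"
            using nv'(1)[of w] by (auto split: if_splits)
          then show ?thesis using t False True by (simp add: out_def)
        next
          case uv: False
          then have "u \<in> ?t ` {u. out' w u} \<longleftrightarrow> out' w u \<and> {w, u} \<noteq> {a, b}"
            by (auto split: if_splits)
          then show ?thesis using False uv by (simp add: out_def)
        qed
      qed
      moreover have "inj_on ?t {u. out' w u}"
        using nv' by (auto simp: inj_on_def doubleton_eq_iff)
      then have "card (?t ` {u. out' w u}) = card {u. out' w u}" by (rule card_image)
      ultimately have "card {u. out w u} = card {u. out' w u}" by (rule trans[OF arg_cong[of _ _ card]])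
      then show ?thesis using o.out_card[of w] w False by simp
    qed
    show "\<not> ?L (u, s0)" if e: "{u, s0} \<in> E" for u
    proof (cases "u = v")
      case True
      then have "s0 = a \<or> s0 = b \<or> s0 = c" using e by (simp add: edge_v_iff)
      then show ?thesis using True o.L_s0[of a] o.L_s0[of b] o.L_s0[of pc] special_E'
        by (elim disjE) (simp_all add: lab_values)
    next
      case False
      then show ?thesis using o.L_s0[of u] e s in_E' lab_same by simp
    qed
    show "?L (u, s1)" if e: "{u, s1} \<in> E" for u
    proof (cases "u = v")
      case True
      then have "s1 = a \<or> s1 = b \<or> s1 = c" using e by (simp add: edge_v_iff)
      then show ?thesis using True o.L_s1[of a] o.L_s1[of b] o.L_s1[of pc] special_E'
        by (elim disjE) (simp_all add: lab_values)
    next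
      case False
      then show ?thesis using o.L_s1[of u] e s in_E' lab_same by simp
    qed
    show "(?L (u, w) \<noteq> ?L (rot w u, w)) = out w (rot w u)" if e: "{u, w} \<in> E" for u w
    proof (cases "w = v")
      case True
      then have "u = a \<or> u = b \<or> u = c" using e by (simp add: edge_v_iff)
      then show ?thesis using abc xor
        by (elim disjE) (auto simp add: True rot_v lab_values out_def)
    next
      case wv: False
      have outw: "out w y = out' w y" if "{w, y} \<in> E" "y \<noteq> v" for y
      proof -
        have "{w, y} \<noteq> {a, b}" using that(1) nab by metis
        then show ?thesis using that(2) wv by (simp add: out_def)
      qed
      show ?thesis
      proof (cases "u = v")
        case True
        have y: "{w, rot w v} \<in> E" using rot_edge[OF simple rots e] True by (simp add: insert_commute)
        have "w = a \<or> w = b \<or> w = c" using e True by (simp add: edge_v_iff)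
        then consider "w = a" | "w = b" | "w = c" by blast
        then show ?thesis
        proof cases
          case 1
          then show ?thesis using o.switch[OF special_E'(2)] True outw[OF y] pa(4) neq_v
            by (simp add: lab_values lab_same rot'_values)
        next
          case 2
          then show ?thesis using o.switch[OF special_E'(1)] True outw[OF y] pb(4) neq_v
            by (simp add: lab_values lab_same rot'_values)
        next
          case 3
          then show ?thesis using o.switch[OF special_E'(5)] True outw[OF y] pc(4) neq_v
            by (simp add: lab_values lab_same rot'_values)
        qed
      next
        case uv: False
        then have e': "{u, w} \<in> E'" using in_E'[OF e] wv by blast
        have y: "{w, rot w u} \<in> E" using rot_edge[OF simple rots e] by (simp add: insert_commute)
        show ?thesis
        proof (cases "rot w u = v")
          case True
          then consider "w = a" "u = pa" | "w = b" "u = pb" | "w = c" "u = pc" using rot_eq_v[OF e] by blast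
          then show ?thesis
          proof cases
            case 1
            then show ?thesis using o.switch[OF special_E'(3)] neq_v abc pa(2,3)
              by (simp add: lab_values lab_same rot'_values out_def)
          next
            case 2
            then show ?thesis using o.switch[OF special_E'(4)] neq_v abc pb(2,3)
              by (simp add: lab_values lab_same rot'_values out_def)
          next
            case 3
            then show ?thesis using neq_v abc pc(2,3)
              by (simp add: lab_values lab_same out_def)
          qed
        next
          case False
          then show ?thesis using o.switch[OF e'] rot'_same[OF e] outw[OF y] uv wv
            by (simp add: lab_same)
        qed
      qed
    qed
    show "\<not> monochromatic E rot ?L k S" for k S by (rule z)
  qed
  then show ?thesis by blast
qed

end

subsection \<open>Existence of labelings\<close>

lemma laman_2_vertices:
  assumes l: "laman_graph V E" and n: "card V = 2" and e: "{s0, s1} \<in> E"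
  shows "E = {{s0, s1}}" "V = {s0, s1}"
proof -
  have s: "simple_graph V E" using l by (simp add: laman_graph_def)
  have "card E = 1" using l n by (simp add: laman_graph_def)
  then show "E = {{s0, s1}}" using e by (auto simp: card_1_singleton_iff)
  have "finite V" using s by (simp add: simple_graph_def)
  then show "V = {s0, s1}" using simple_graph_edge[OF s e] n
    by (intro card_subset_eq[symmetric]) auto
qed

text \<open>The only face contains both darts, whose labels differ because one ends at
  \<open>s0\<close> and the other at \<open>s1\<close>.\<close>

lemma oriented_labeling_single_edge:
  assumes s: "simple_graph {s0, s1} {{s0, s1}}" and r: "rotation_system {s0, s1} {{s0, s1}} rot"
  shows "oriented_labeling {s0, s1} {{s0, s1}} rot s0 s1 (\<lambda>_ _. False) (\<lambda>d. snd d = s1)"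
proof -
  have ne: "s0 \<noteq> s1" using simple_graph_edge[OF s] by auto
  have d: "darts {{s0, s1}} = {(s0, s1), (s1, s0)}" by (auto simp: darts_def doubleton_eq_iff)
  have rs: "rot s0 s1 = s1" "rot s1 s0 = s0"
    using rot_edge[OF s r, of s1 s0] rot_edge[OF s r, of s0 s1] ne by (auto simp: doubleton_eq_iff)
  show ?thesis
  proof
    show "\<not> monochromatic {{s0, s1}} rot (\<lambda>d. snd d = s1) k S" for k S
    proof
      assume m: "monochromatic {{s0, s1}} rot (\<lambda>d. snd d = s1) k S"
      then have "S \<subseteq> {(s0, s1), (s1, s0)}" "S \<noteq> {}" "face_step rot ` S \<subseteq> S" "\<forall>d\<in>S. (snd d = s1) = k"
        by (auto simp: monochromatic_def d)
      moreover have "face_step rot (s0, s1) = (s1, s0)" "face_step rot (s1, s0) = (s0, s1)"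
        using rs by (auto simp: face_step_def)
      moreover have "(s0, s1) \<in> S \<or> (s1, s0) \<in> S" using calculation(1,2) by blast
      ultimately have "(s0, s1) \<in> S" "(s1, s0) \<in> S" by (metis image_subset_iff)+
      then have "(s1 = s1) = k" "(s0 = s1) = k" using \<open>\<forall>d\<in>S. (snd d = s1) = k\<close> by (metis snd_conv)+
      then show False using ne by simp
    qed
  qed (use ne in \<open>auto simp: doubleton_eq_iff\<close>)
qed

text \<open>The two cyclic orders of three points turn into each other when \<open>a\<close> and
  \<open>b\<close> are exchanged.\<close>

lemma cyclic_on_3:
  assumes "cyclic_on f {a, b, c}" "a \<noteq> b" "b \<noteq> c" "a \<noteq> c"
  shows "(f b = a \<and> f a = c \<and> f c = b) \<or> (f a = b \<and> f b = c \<and> f c = a)"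
proof -
  have c3: "card {a, b, c} \<ge> 2" using assms by simp
  have nf: "f x \<noteq> x" if "x \<in> {a, b, c}" for x using cyclic_on_pred(2)[OF assms(1) that c3] .
  have im: "f ` {a, b, c} = {a, b, c}" and inj: "inj_on f {a, b, c}"
    using assms(1) by (auto simp: cyclic_on_def bij_betw_def)
  have "f a \<in> {a, b, c}" "f b \<in> {a, b, c}" "f c \<in> {a, b, c}" using im by blast+
  moreover have "f a \<noteq> f b" "f b \<noteq> f c" "f a \<noteq> f c" using inj assms(2-) by (auto simp: inj_on_def)
  ultimately show ?thesis using nf[of a] nf[of b] nf[of c] by auto
qed

text \<open>\<open>s0\<close> and \<open>s1\<close> stay fixed in the induction: the removed vertex
  differs from both, so their edge survives every reduction.\<close>

lemma oriented_labeling_exists: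
  assumes "laman_graph V E" "rotation_system V E rot" "{s0, s1} \<in> E"
  shows "\<exists>out L. oriented_labeling V E rot s0 s1 out L"
  using assms
proof (induction "card V" arbitrary: V E rot rule: less_induct)
  case less
  note l = less.prems(1) and r = less.prems(2) and e = less.prems(3)
  have s: "simple_graph V E" using l by (simp add: laman_graph_def)
  then interpret embedded_graph V E rot using r by unfold_locales
  have fin: "finite V" using s by (simp add: simple_graph_def)
  have "card {s0, s1} \<le> card V" using simple_graph_edge[OF s e] fin by (intro card_mono) auto
  then have n2: "card V \<ge> 2" using simple_graph_edge[OF s e] by simp
  show ?case
  proof (cases "card V = 2")
    case True
    then show ?thesis
      using laman_2_vertices[OF l True e] oriented_labeling_single_edge[of s0 s1 rot] s r by blast
  next
    case False
    then have n3: "card V \<ge> 3" using n2 by simp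
    obtain v where vV: "v \<in> V" "v \<noteq> s0" "v \<noteq> s1" and d: "card (nbrs E v) \<in> {2, 3}"
      using laman_small_degree[OF l n3 e] by blast
    have smaller: "card (V - {v}) < card V" using vV fin by (intro card_Diff1_less)
    \<comment> \<open>Minimum degree 2 guarantees a predecessor different from \<open>v\<close> in
      the rotation at each neighbour.\<close>
    have pre: "\<exists>p. {p, u} \<in> E \<and> p \<noteq> v \<and> rot u p = v \<and> rot u v \<noteq> v" if "u \<in> nbrs E v" for u
    proof -
      have e: "{u, v} \<in> E" using that by (simp add: nbrs_def)
      then have u: "u \<in> V" using simple_graph_edge[OF s] by blast
      have vu: "v \<in> nbrs E u" using e by (simp add: nbrs_def insert_commute)
      show ?thesis
        using cyclic_on_pred[OF rotation_cyclic[OF r u] vu laman_min_degree[OF l u n3]]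
        unfolding nbrs_def by blast
    qed
    show ?thesis
    proof (cases "card (nbrs E v) = 2")
      case True
      then obtain a b where ab: "nbrs E v = {a, b}" "a \<noteq> b" by (auto simp: card_2_iff)
      obtain pa where pa: "{pa, a} \<in> E" "pa \<noteq> v" "rot a pa = v" "rot a v \<noteq> v" using pre[of a] ab by blast
      obtain pb where pb: "{pb, b} \<in> E" "pb \<noteq> v" "rot b pb = v" "rot b v \<noteq> v" using pre[of b] ab by blast
      interpret degree_2 V E rot v a b pa pb using vV ab pa pb by unfold_locales
      have "laman_graph (V - {v}) E'" unfolding E'_def by (rule laman_remove_degree_2[OF l vV(1) True])
      moreover have "rotation_system (V - {v}) E' rot'" using embedded' by (simp add: embedded_graph_def)
      moreover have "{s0, s1} \<in> E'" using e vV(2,3) by (simp add: E'_iff)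
      ultimately show ?thesis using less.hyps[OF smaller] extend_labeling vV by blast
    next
      case False
      then have d3: "card (nbrs E v) = 3" using d by simp
      obtain a' b' c where abc': "nbrs E v = {a', b', c}" "a' \<noteq> b'" "b' \<noteq> c" "a' \<noteq> c" "{a', b'} \<notin> E"
        "laman_graph (V - {v}) (insert {a', b'} {e \<in> E. v \<notin> e})"
        using laman_reduce_degree_3[OF l vV(1) d3] by blast
      \<comment> \<open>\<open>degree_3\<close> asks for the order \<open>b\<close>,
        \<open>a\<close>, \<open>c\<close> around \<open>v\<close>; for the mirrored order the ends
        of the new edge exchange their names.\<close>
      have "\<exists>a b. nbrs E v = {a, b, c} \<and> a \<noteq> b \<and> b \<noteq> c \<and> a \<noteq> c \<and> {a, b} = {a', b'}
          \<and> rot v b = a \<and> rot v a = c \<and> rot v c = b"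
      proof -
        have "cyclic_on (rot v) {a', b', c}" using rotation_cyclic[OF r vV(1)] abc'(1) by simp
        from cyclic_on_3[OF this abc'(2-4)] show ?thesis
        proof
          assume "rot v b' = a' \<and> rot v a' = c \<and> rot v c = b'"
          then show ?thesis using abc' by blast
        next
          assume rv': "rot v a' = b' \<and> rot v b' = c \<and> rot v c = a'"
          have "nbrs E v = {b', a', c}" "{b', a'} = {a', b'}" using abc'(1) by (simp_all add: insert_commute)
          then show ?thesis using abc'(2-4) rv' by metis
        qed
      qed
      then obtain a b where nb: "nbrs E v = {a, b, c}" "a \<noteq> b" "b \<noteq> c" "a \<noteq> c" "{a, b} = {a', b'}"
        and rv: "rot v b = a" "rot v a = c" "rot v c = b" by blast
      obtain pa where pa: "{pa, a} \<in> E" "pa \<noteq> v" "rot a pa = v" "rot a v \<noteq> v" using pre[of a] nb by blast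
      obtain pb where pb: "{pb, b} \<in> E" "pb \<noteq> v" "rot b pb = v" "rot b v \<noteq> v" using pre[of b] nb by blast
      obtain pc where pc: "{pc, c} \<in> E" "pc \<noteq> v" "rot c pc = v" "rot c v \<noteq> v" using pre[of c] nb by blast
      have nab: "{a, b} \<notin> E" using nb(5) abc'(5) by simp
      interpret degree_3 V E rot v a b c pa pb pc using vV nb(1-4) nab rv pa pb pc by unfold_locales
      have "laman_graph (V - {v}) E'" unfolding E'_def using nb(5) abc'(6) by simp
      moreover have "rotation_system (V - {v}) E' rot'" using embedded' by (simp add: embedded_graph_def)
      moreover have "{s0, s1} \<in> E'" using e vV(2,3) by (simp add: E'_iff)
      ultimately show ?thesis using less.hyps[OF smaller] extend_labeling vV e by blast
    qed
  qed
qed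

subsection \<open>Counting label changes\<close>

lemma face_cyclic:
  assumes "simple_graph V E" "rotation_system V E rot" "F \<in> faces E rot"
  shows "cyclic_on (face_step rot) F" "F \<subseteq> darts E" "F \<noteq> {}"
proof -
  obtain d where d: "d \<in> darts E" "F = face_of rot d" using assms(3) by (auto simp: faces_def)
  show "cyclic_on (face_step rot) F"
    unfolding d(2) face_of_def
    by (rule cyclic_on_orbit[OF finite_darts[OF assms(1)] face_step_bij[OF assms(1,2)] d(1)])
  have "(face_step rot ^^ n) d \<in> darts E" for n
    using face_step_bij[OF assms(1,2)] d(1) by (induction n) (auto simp: bij_betw_def)
  then show "F \<subseteq> darts E" unfolding d(2) face_of_def by blast
  show "F \<noteq> {}" unfolding d(2) face_of_def by blast
qed

text \<open>The intersection of two closed sets is closed, so by minimality it is empty or equal to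
  both faces.\<close>

lemma faces_disjoint:
  assumes "simple_graph V E" "rotation_system V E rot" "F \<in> faces E rot" "G \<in> faces E rot" "F \<noteq> G"
  shows "F \<inter> G = {}"
proof (rule ccontr)
  assume ne: "F \<inter> G \<noteq> {}"
  have c: "cyclic_on (face_step rot) F" "cyclic_on (face_step rot) G" using face_cyclic assms by blast+
  then have "face_step rot ` F \<subseteq> F" "face_step rot ` G \<subseteq> G"
    by (auto simp: cyclic_on_def bij_betw_def)
  then have "face_step rot ` (F \<inter> G) \<subseteq> F \<inter> G" by blast
  then have "F \<inter> G = F" "F \<inter> G = G"
    using c ne unfolding cyclic_on_iff_minimal by (meson inf_le1 inf_le2)+
  then show False using assms(5) by blast
qed

context oriented_labeling
begin

text \<open>A switch at \<open>d\<close> is charged to the edge of the next dart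
  \<open>face_step rot d\<close>. Every edge other than the special one is charged from at most one
  of its two sides.\<close>

lemma card_all_switches:
  assumes s: "simple_graph V E" and r: "rotation_system V E rot" and e: "{s0, s1} \<in> E"
  shows "card (switches (face_step rot) (darts E) L) \<le> card E + 1"
proof -
  let ?W = "switches (face_step rot) (darts E) L"
  let ?f = "face_step rot"
  define ed where "ed d = {fst (?f d), snd (?f d)}" for d
  have finE: "finite E" by (rule simple_graph_finite_edges[OF s])
  have inj: "inj_on ?f (darts E)" and into: "?f ` darts E = darts E"
    using face_step_bij[OF s r] by (auto simp: bij_betw_def)
  define W1 where "W1 = {d \<in> ?W. ed d \<noteq> {s0, s1}}"
  define W2 where "W2 = {d \<in> ?W. ed d = {s0, s1}}"
  have WD: "?W \<subseteq> darts E" by (auto simp: switches_def)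
  have edE: "ed d \<in> E" if "d \<in> darts E" for d
  proof -
    have "?f d \<in> darts E" using into that by blast
    then show ?thesis by (auto simp: ed_def darts_def)
  qed
  have "inj_on ed W1"
  proof (rule inj_onI)
    fix d d' assume d: "d \<in> W1" "d' \<in> W1" "ed d = ed d'"
    obtain u w where uw: "d = (u, w)" by force
    obtain u' w' where uw': "d' = (u', w')" by force
    have D: "d \<in> darts E" "d' \<in> darts E" using d WD by (auto simp: W1_def)
    then have uE: "{u, w} \<in> E" "{u', w'} \<in> E" using uw uw' by (auto simp: darts_def)
    show "d = d'"
    proof (rule ccontr)
      assume "d \<noteq> d'"
      then have "?f d \<noteq> ?f d'" using inj D by (meson inj_onD)
      then have sw: "rot w u = w'" "rot w' u' = w"
        using d(3) uw uw' by (auto simp: ed_def face_step_def doubleton_eq_iff)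
      have L1: "L (u, w) \<noteq> L (w, w')" using d(1) uw sw by (auto simp: W1_def switches_def face_step_def)
      have L2: "L (u', w') \<noteq> L (w', w)" using d(2) uw' sw by (auto simp: W1_def switches_def face_step_def)
      \<comment> \<open>\<open>switch\<close> pairs the four labels around the edge by endpoint
        instead of by side. Both pairings have the same parity of differing pairs, and by endpoint
        exactly one pair differs, so both sides cannot change.\<close>
      have "(L (u, w) \<noteq> L (w', w)) = out w w'" using switch[OF uE(1)] sw by simp
      moreover have "(L (u', w') \<noteq> L (w, w')) = out w' w" using switch[OF uE(2)] sw by simp
      moreover have "out w w' \<noteq> out w' w"
      proof (rule out_xor)
        have "ed d = {w, w'}" using uw sw by (simp add: ed_def face_step_def)
        then show "{w, w'} \<in> E" "{w, w'} \<noteq> {s0, s1}" using edE[OF D(1)] d(1) by (auto simp: W1_def)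
      qed
      ultimately show False using L1 L2 by auto
    qed
  qed
  moreover have "ed ` W1 \<subseteq> E - {{s0, s1}}" using edE WD by (auto simp: W1_def)
  ultimately have c1: "card W1 \<le> card (E - {{s0, s1}})" using finE by (intro card_inj_on_le) auto
  \<comment> \<open>Along the special edge both sides may change, hence the summand 1 beyond one
    change per edge.\<close>
  have "inj_on ?f W2" by (rule inj_on_subset[OF inj]) (use WD in \<open>auto simp: W2_def\<close>)
  moreover have "?f ` W2 \<subseteq> {(s0, s1), (s1, s0)}"
    by (auto simp: W2_def ed_def face_step_def doubleton_eq_iff)
  ultimately have "card W2 \<le> card {(s0, s1), (s1, s0)}" by (intro card_inj_on_le) auto
  then have c2: "card W2 \<le> 2" using card_insert_le_m1[of 2 "{(s1, s0)}" "(s0, s1)"] by simp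
  have "?W = W1 \<union> W2" by (auto simp: W1_def W2_def)
  then have "card ?W \<le> card W1 + card W2" by (simp add: card_Un_le)
  moreover have "card E > 0" using e finE by (auto simp: card_gt_0_iff)
  ultimately show ?thesis using c1 c2 e finE by simp
qed

text \<open>No face is monochromatic, so each has at least two switches; the total is at most twice
  the number of faces, which leaves no room for more.\<close>

lemma two_switches_per_face:
  assumes s: "simple_graph V E" and r: "rotation_system V E rot" and e: "{s0, s1} \<in> E"
    and n: "card E + 1 \<le> 2 * card (faces E rot)" and F: "F \<in> faces E rot"
  shows "card (switches (face_step rot) F L) = 2"
proof -
  let ?f = "face_step rot"
  have finF: "finite (faces E rot)" using finite_darts[OF s] by (simp add: faces_def)
  have ge: "card (switches ?f G L) \<ge> 2" if G: "G \<in> faces E rot" for G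
  proof (rule card_switches_ge_2)
    note fc = face_cyclic[OF s r G]
    show "cyclic_on ?f G" by (rule fc(1))
    then have "?f ` G \<subseteq> G" by (auto simp: cyclic_on_def bij_betw_def)
    then have "\<exists>d\<in>G. L d \<noteq> k" for k
      using not_mono[of k G] fc(2,3) unfolding monochromatic_def by blast
    from this[of False] this[of True] show "\<exists>x\<in>G. L x" "\<exists>x\<in>G. \<not> L x" by auto
  qed
  have finS: "finite (switches ?f G L)" if "G \<in> faces E rot" for G
    using face_cyclic(1)[OF s r that] by (simp add: switches_def cyclic_on_def)
  have "(\<Sum>G\<in>faces E rot. card (switches ?f G L)) = card (\<Union>G\<in>faces E rot. switches ?f G L)"
  proof (rule card_UN_disjoint[symmetric, OF finF])
    show "\<forall>i\<in>faces E rot. finite (switches ?f i L)" using finS by blast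
    show "\<forall>i\<in>faces E rot. \<forall>j\<in>faces E rot. i \<noteq> j \<longrightarrow> switches ?f i L \<inter> switches ?f j L = {}"
    proof (intro ballI impI)
      fix i j assume "i \<in> faces E rot" "j \<in> faces E rot" "i \<noteq> j"
      then have "i \<inter> j = {}" by (rule faces_disjoint[OF s r])
      then show "switches ?f i L \<inter> switches ?f j L = {}" by (auto simp: switches_def)
    qed
  qed
  also have "\<dots> \<le> card (switches ?f (darts E) L)"
  proof (rule card_mono)
    show "finite (switches ?f (darts E) L)" using finite_darts[OF s] by (simp add: switches_def)
    show "(\<Union>G\<in>faces E rot. switches ?f G L) \<subseteq> switches ?f (darts E) L"
      using face_cyclic(2)[OF s r] by (auto simp: switches_def)
  qed
  also have "\<dots> \<le> 2 * card (faces E rot)" using card_all_switches[OF s r e] n by simp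
  finally have total: "(\<Sum>G\<in>faces E rot. card (switches ?f G L)) \<le> 2 * card (faces E rot)" .
  have "(\<Sum>G\<in>faces E rot. card (switches ?f G L)) = card (switches ?f F L) + (\<Sum>G\<in>faces E rot - {F}. card (switches ?f G L))"
    using F finF by (simp add: sum.remove)
  moreover have "2 * card (faces E rot - {F}) \<le> (\<Sum>G\<in>faces E rot - {F}. card (switches ?f G L))"
    using sum_bounded_below[of "faces E rot - {F}" 2 "\<lambda>G. card (switches ?f G L)"] ge by simp
  moreover have "card (faces E rot) = card (faces E rot - {F}) + 1"
    using F finF by (simp add: card_gt_0_iff) (metis Suc_pred card_gt_0_iff empty_iff)
  ultimately have "card (switches ?f F L) \<le> 2" using total by linarith
  then show ?thesis using ge[OF F] by simp
qed

text \<open>\<open>rot w\<close> maps the switches around \<open>w\<close> bijectively onto the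
  heads of the outgoing edges, of which there are two.\<close>

lemma two_switches_per_vertex:
  assumes s: "simple_graph V E" and r: "rotation_system V E rot" and w: "w \<in> V - {s0, s1}"
  shows "card (switches (rot w) (nbrs E w) (\<lambda>u. L (u, w))) = 2"
proof -
  have bij: "bij_betw (rot w) (nbrs E w) (nbrs E w)"
    using rotation_cyclic[OF r, of w] w by (simp add: cyclic_on_def)
  have sw: "(L (u, w) \<noteq> L (rot w u, w)) = out w (rot w u)" if "u \<in> nbrs E w" for u
    using switch that by (simp add: nbrs_def)
  have on: "y \<in> nbrs E w" if "out w y" for y using out_edge[OF that] by (simp add: nbrs_def insert_commute)
  have "bij_betw (rot w) (switches (rot w) (nbrs E w) (\<lambda>u. L (u, w))) {y. out w y}"
    unfolding bij_betw_def
  proof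
    show "inj_on (rot w) (switches (rot w) (nbrs E w) (\<lambda>u. L (u, w)))"
      using bij by (auto simp: bij_betw_def switches_def intro: inj_on_subset)
    show "rot w ` switches (rot w) (nbrs E w) (\<lambda>u. L (u, w)) = {y. out w y}"
    proof
      show "{y. out w y} \<subseteq> rot w ` switches (rot w) (nbrs E w) (\<lambda>u. L (u, w))"
      proof
        fix y assume y: "y \<in> {y. out w y}"
        then have "y \<in> rot w ` nbrs E w" using on bij by (simp add: bij_betw_def)
        then obtain u where "u \<in> nbrs E w" "y = rot w u" by blast
        then show "y \<in> rot w ` switches (rot w) (nbrs E w) (\<lambda>u. L (u, w))"
          using sw[of u] y by (auto simp: switches_def)
      qed
    qed (use sw in \<open>auto simp: switches_def\<close>)
  qed
  then show ?thesis using bij_betw_same_card out_card[OF w] by metis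
qed

text \<open>\<open>u\<close> has exactly one predecessor in the rotation at \<open>w\<close>, so the
  quantifier in \<open>sides_coincide_at\<close> concerns a single angle, which
  \<open>switch\<close> compares with \<open>(u, w)\<close>.\<close>

lemma sides_coincide_iff:
  assumes s: "simple_graph V E" and r: "rotation_system V E rot" and e: "{u, w} \<in> E"
  shows "sides_coincide_at E rot (\<lambda>d. if L d then 1 else 0) w u \<longleftrightarrow> \<not> out w u"
proof -
  have w: "w \<in> V" using simple_graph_edge[OF s e] by blast
  have "u \<in> rot w ` nbrs E w"
    using rotation_cyclic[OF r w] e by (auto simp: cyclic_on_def bij_betw_def nbrs_def)
  then obtain x where x: "{x, w} \<in> E" "rot w x = u" by (auto simp: nbrs_def)
  have "x' = x" if "{x', w} \<in> E" "rot w x' = u" for x' using rot_inj[OF s r that(1) x(1)] that x by simp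
  then have "sides_coincide_at E rot (\<lambda>d. if L d then 1 else 0) w u \<longleftrightarrow> L (x, w) = L (u, w)"
    using x unfolding sides_coincide_at_def by (metis one_neq_zero)
  then show ?thesis using switch[OF x(1)] x(2) by blast
qed

lemma extended_weak_labeling:
  assumes p: "plane_embedding V E rot" and l: "laman_graph V E" and e: "{s0, s1} \<in> E"
  shows "extended_weak_labeling V E rot (\<lambda>d. if L d then 1 else 0)"
proof -
  have s: "simple_graph V E" and r: "rotation_system V E rot" using p by (auto simp: plane_embedding_def)
  \<comment> \<open>Euler's formula and \<open>2n - 3\<close> edges give \<open>n - 1\<close> faces,
    and \<open>2(n - 1)\<close> is the number of edges plus 1.\<close>
  have n: "card E + 1 \<le> 2 * card (faces E rot)"
    using p l by (auto simp: plane_embedding_def laman_graph_def)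
  show ?thesis
    unfolding extended_weak_labeling_def
  proof (rule conjI, simp, rule exI[of _ s0], rule exI[of _ s1], intro conjI ballI allI impI)
    show "{s0, s1} \<in> E" by (rule e)
    show "(if L (u, s0) then 1 else 0) = (0::nat)" if "u \<in> nbrs E s0" for u
      using that L_s0 by (simp add: nbrs_def)
    show "(if L (u, s1) then 1 else 0) = (1::nat)" if "u \<in> nbrs E s1" for u
      using that L_s1 by (simp add: nbrs_def)
    show "one_interval_each (rot w) (nbrs E w) (\<lambda>u. if L (u, w) then 1 else 0)" if "w \<in> V - {s0, s1}" for w
      using one_interval_each_if_two_switches[OF rotation_cyclic[OF r] two_switches_per_vertex[OF s r that]] that
      by simp
    show "one_interval_each (face_step rot) F (\<lambda>d. if L d then 1 else 0)" if "F \<in> faces E rot" for F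
      using one_interval_each_if_two_switches[OF face_cyclic(1)[OF s r that] two_switches_per_face[OF s r e n that]] .
    fix u w assume uw: "{u, w} \<in> E - {{s0, s1}}"
    then have "{u, w} \<in> E" "{w, u} \<in> E" "{u, w} \<noteq> {s0, s1}" by (auto simp: insert_commute)
    then show "sides_coincide_at E rot (\<lambda>d. if L d then 1 else 0) w u \<noteq>
        sides_coincide_at E rot (\<lambda>d. if L d then 1 else 0) u w"
      using sides_coincide_iff[OF s r] out_xor[of u w] by simp
  qed
qed

end

theorem theorem38:
  fixes V :: "'a set" and E :: "'a set set" and rot :: "'a \<Rightarrow> 'a \<Rightarrow> 'a"
  assumes "laman_graph V E"
    and "plane_embedding V E rot"
  shows "\<exists>l. extended_weak_labeling V E rot l"
proof -
  have s: "simple_graph V E" and r: "rotation_system V E rot"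
    using assms(2) by (auto simp: plane_embedding_def)
  have "int (card E) = 2 * int (card V) - 3" using assms(1) by (simp add: laman_graph_def)
  \<comment> \<open>The number of edges is odd, so there is an edge to serve as
    \<open>s0s1\<close>.\<close>
  then have "card E \<noteq> 0" by presburger
  then have "E \<noteq> {}" by auto
  then obtain s0 s1 where e: "{s0, s1} \<in> E" using simple_graph_edgeE[OF s] by (metis all_not_in_conv)
  obtain out L where "oriented_labeling V E rot s0 s1 out L"
    using oriented_labeling_exists[OF assms(1) r e] by blast
  then show ?thesis using oriented_labeling.extended_weak_labeling[OF _ assms(2,1) e] by blast
qed

end
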